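(* Let $H$, $A$, $A_1,\dots,A_m$, $\eta_1,\dots,\eta_m$, $M$, $f$, $\varphi_0,\varphi_1$, $T$ and the scheme values $v_k$ be as described in the context, and suppose the Cauchy problem $$u''(t)+Au(t)+M(u(t))=f(t),\quad t\in[0,T],\qquad u(0)=\varphi_0,\quad u'(0)=\varphi_1$$ has a solution $u$. If the functions $f(t)$ and $u''(t)$ satisfy on $[0,T]$ a Hölder condition with index $\lambda$ ($0<\lambda\le1$), then there is a constant $c>0$, independent of $n$ (equivalently of $\tau=T/n$) and of $k$, such that $$\left\|u'(t_k)-\frac{v_{k+1}-v_k}{\tau}\right\|\le c\,\tau^\lambda,\qquad k=0,1,\dots,n-1.$$
   Context: $H$ is a Hilbert space with norm $\|\cdot\|$ and inner product $(\cdot,\cdot)$. $A$ is a self-adjoint, positive definite (generally unbounded) operator with dense domain $D(A)\subset H$: $A=A^*$ and $(Au,u)\ge\alpha\|u\|^2$ for all $u\in D(A)$, with a constant $\alpha>0$. Moreover $A=\sum_{j=1}^mA_j$ as unbounded operators (so $D(A)=\bigcap_jD(A_j)$), where each $A_j=A_j^*\ge\alpha_jI$ with constant $\alpha_j>0$. The nonlinear operator $M:H\to H$ satisfies $\|M(u)-M(v)\|\le a\|u-v\|$ for all $u,v\in H$, with a constant $a>0$. $f:[0,T]\to H$ is a given continuous function, $T>0$, and $\varphi_0,\varphi_1\in H$ are given vectors. A solution of the Cauchy problem is a function $u:[0,T]\to H$ such that (a) $u$ is twice continuously differentiable on $[0,T]$; (b) $u(t)\in D(A)$ for all $t\in[0,T]$,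 and $Au(t)$ and $M(u(t))$ are continuous in $t$; (c) $u$ satisfies the equation on $[0,T]$ and the initial conditions. Scheme: fix weights $\eta_j$ with $0<\eta_j<1$, $\sum_{j=1}^m\eta_j=1$. For an integer $n>1$ let $\tau=T/n$, $t_k=k\tau$. Set $v_0=\varphi_0$, $v_1=\varphi_0+\tau\varphi_1$, and for $k=1,\dots,n-1$ set $v_{k+1}=\sum_{j=1}^m\eta_jy_{j,k+1}$, where $y_{j,k+1}$ ($j=1,\dots,m$) solves $$\eta_j\frac{y_{j,k+1}-2v_k+v_{k-1}}{\tau^2}+A_jy_{j,k+1}=\delta_{1,j}\left[f(t_k)-M(v_k)\right],$$ with $\delta_{1,j}$ the Kronecker symbol. An $H$-valued function $w$ satisfies a Hölder condition with index $\lambda$ on $[0,T]$ if $\|w(t)-w(s)\|\le C|t-s|^\lambda$ for all $s,t\in[0,T]$ and some constant $C$. *)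

theory Defs
  imports "HOL-Analysis.Analysis"
begin

text \<open>
  A Hilbert space is a type of sort \<open>{real_inner, banach}\<close>.  This also covers a complex Hilbert
  space, regarded as a real one with the real part of its inner product: norms, adjoints, and
  hence self-adjointness and lower bounds of complex-linear operators are unchanged.

  An unbounded operator is given by a domain \<open>D\<close> and a total function \<open>A\<close> whose values outside
  \<open>D\<close> are irrelevant; only its graph over \<open>D\<close> enters.
\<close>

definition linear_operator :: "'a::real_vector set \<Rightarrow> ('a \<Rightarrow> 'a) \<Rightarrow> bool" where
  "linear_operator D A \<longleftrightarrow> subspace D \<and>
     (\<forall>x\<in>D. \<forall>y\<in>D. A (x + y) = A x + A y) \<and>
     (\<forall>c. \<forall>x\<in>D. A (c *\<^sub>R x) = c *\<^sub>R A x)"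

definition operator_graph :: "'a set \<Rightarrow> ('a \<Rightarrow> 'a) \<Rightarrow> ('a \<times> 'a) set" where
  "operator_graph D A = {(x, A x) |x. x \<in> D}"

text \<open>The graph of the adjoint; single-valued when \<open>D\<close> is dense.\<close>

definition adjoint_graph :: "'a::real_inner set \<Rightarrow> ('a \<Rightarrow> 'a) \<Rightarrow> ('a \<times> 'a) set" where
  "adjoint_graph D A = {(v, w). \<forall>x\<in>D. A x \<bullet> v = x \<bullet> w}"

definition self_adjoint :: "'a::real_inner set \<Rightarrow> ('a \<Rightarrow> 'a) \<Rightarrow> bool" where
  "self_adjoint D A \<longleftrightarrow>
     linear_operator D A \<and> closure D = UNIV \<and> operator_graph D A = adjoint_graph D A"

definition bounded_below_by :: "real \<Rightarrow> 'a::real_inner set \<Rightarrow> ('a \<Rightarrow> 'a) \<Rightarrow> bool" where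
  "bounded_below_by \<alpha> D A \<longleftrightarrow> (\<forall>x\<in>D. A x \<bullet> x \<ge> \<alpha> * (norm x)\<^sup>2)"

definition holder_condition :: "real \<Rightarrow> real set \<Rightarrow> (real \<Rightarrow> 'a::real_normed_vector) \<Rightarrow> bool" where
  "holder_condition lam S w \<longleftrightarrow>
     (\<exists>C. \<forall>t\<in>S. \<forall>s\<in>S. norm (w t - w s) \<le> C * \<bar>t - s\<bar> powr lam)"

text \<open>
  \<open>u\<close> solves \<open>u'' + A u + M u = f\<close>, \<open>u 0 = \<phi>0\<close>, \<open>u' 0 = \<phi>1\<close> on \<open>[0, T]\<close>, with first and second
  derivatives \<open>u'\<close> and \<open>u''\<close>.  Derivatives at the end points are one-sided.
\<close>

definition cauchy_solution ::
  "'a::real_inner set \<Rightarrow> ('a \<Rightarrow> 'a) \<Rightarrow> ('a \<Rightarrow> 'a) \<Rightarrow> (real \<Rightarrow> 'a) \<Rightarrow> 'a \<Rightarrow> 'a \<Rightarrow> real \<Rightarrow>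
   (real \<Rightarrow> 'a) \<Rightarrow> (real \<Rightarrow> 'a) \<Rightarrow> (real \<Rightarrow> 'a) \<Rightarrow> bool" where
  "cauchy_solution D A M f \<phi>0 \<phi>1 T u u' u'' \<longleftrightarrow>
     (\<forall>t\<in>{0..T}. (u has_vector_derivative u' t) (at t within {0..T})) \<and>
     (\<forall>t\<in>{0..T}. (u' has_vector_derivative u'' t) (at t within {0..T})) \<and>
     continuous_on {0..T} u'' \<and>
     (\<forall>t\<in>{0..T}. u t \<in> D) \<and>
     continuous_on {0..T} (\<lambda>t. A (u t)) \<and>
     continuous_on {0..T} (\<lambda>t. M (u t)) \<and>
     (\<forall>t\<in>{0..T}. u'' t + A (u t) + M (u t) = f t) \<and>
     u 0 = \<phi>0 \<and> u' 0 = \<phi>1"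

text \<open>
  \<open>v k\<close> for \<open>k \<le> n\<close> and \<open>y j k\<close> for \<open>1 \<le> j \<le> m\<close>, \<open>2 \<le> k \<le> n\<close> are values produced by the scheme
  with step \<open>T / n\<close>; \<open>y j k\<close> solving its equation includes membership in the domain \<open>D j\<close>.
\<close>

definition scheme_values ::
  "nat \<Rightarrow> (nat \<Rightarrow> 'a::real_inner set) \<Rightarrow> (nat \<Rightarrow> 'a \<Rightarrow> 'a) \<Rightarrow> (nat \<Rightarrow> real) \<Rightarrow> ('a \<Rightarrow> 'a) \<Rightarrow>
   (real \<Rightarrow> 'a) \<Rightarrow> 'a \<Rightarrow> 'a \<Rightarrow> real \<Rightarrow> nat \<Rightarrow> (nat \<Rightarrow> 'a) \<Rightarrow> (nat \<Rightarrow> nat \<Rightarrow> 'a) \<Rightarrow> bool" where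
  "scheme_values m D A \<eta> M f \<phi>0 \<phi>1 T n v y \<longleftrightarrow>
     (let \<tau> = T / real n in
       v 0 = \<phi>0 \<and> v 1 = \<phi>0 + \<tau> *\<^sub>R \<phi>1 \<and>
       (\<forall>k\<in>{1..n - 1}.
          v (k + 1) = (\<Sum>j=1..m. \<eta> j *\<^sub>R y j (k + 1)) \<and>
          (\<forall>j\<in>{1..m}. y j (k + 1) \<in> D j \<and>
             \<eta> j *\<^sub>R ((y j (k + 1) - 2 *\<^sub>R v k + v (k - 1)) /\<^sub>R \<tau>\<^sup>2) + A j (y j (k + 1)) =
               (if j = 1 then f (real k * \<tau>) - M (v k) else 0))))"

end

theory Submission
  imports Defs
begin

text \<open>
  The errors \<open>Y\<^sub>j\<^sup>k = u(t\<^sub>k) - y\<^sub>j\<^sub>,\<^sub>k\<close> and \<open>z\<^sub>k = u(t\<^sub>k) - v\<^sub>k = \<Sum> \<eta>\<^sub>j Y\<^sub>j\<^sup>k\<close> satisfy the scheme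
  with a residual \<open>q\<^sub>j + \<epsilon>\<^sub>j\<close>, where \<open>\<epsilon>\<^sub>j\<close> is of order \<open>\<tau>\<^sup>\<lambda> + \<parallel>z\<^sub>k\<parallel>\<close>, but \<open>q\<^sub>j\<close>, the error of
  the splitting, does not tend to zero; it is only balanced, \<open>\<Sum> \<eta>\<^sub>j q\<^sub>j = 0\<close>.  Testing the
  \<open>j\<close>-th error equation with the increment of \<open>Y\<^sub>j\<close> gives an energy inequality in which, by
  balance, \<open>q\<^sub>j\<close> meets only the increments of the deviation \<open>Y\<^sub>j - z\<close>.  Summation by parts in \<open>k\<close>
  moves the difference onto \<open>q\<^sub>j\<close>, which is Hoelder continuous in time because every \<open>A\<^sub>j\<close> is
  bounded relative to \<open>A\<close>.  A Gronwall argument finishes.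
\<close>

subsection \<open>Relative boundedness\<close>

lemma linear_operator_diff:
  assumes "linear_operator D A" "x \<in> D" "y \<in> D"
  shows "A (x - y) = A x - A y"
proof -
  have s: "subspace D" and add: "\<And>x y. x \<in> D \<Longrightarrow> y \<in> D \<Longrightarrow> A (x + y) = A x + A y"
    and sc: "\<And>c x. x \<in> D \<Longrightarrow> A (c *\<^sub>R x) = c *\<^sub>R A x"
    using assms(1) by (auto simp: linear_operator_def)
  have "A (x + (-1) *\<^sub>R y) = A x + A ((-1) *\<^sub>R y)"
    using assms(2,3) s by (intro add) (auto intro: subspace_scale subspace_neg)
  then show ?thesis using sc[OF assms(3), of "-1"] by simp
qed

lemma linear_operator_zero:
  assumes "linear_operator D A"
  shows "A 0 = 0"
  using linear_operator_diff[OF assms, of 0 0] assms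
  by (auto simp: linear_operator_def subspace_0)

lemma self_adjointD:
  assumes "self_adjoint D A"
  shows "linear_operator D A" "subspace D" "closure D = UNIV"
  using assms by (auto simp: self_adjoint_def linear_operator_def)

lemma self_adjoint_symmetric:
  assumes "self_adjoint D A" "x \<in> D" "y \<in> D"
  shows "A x \<bullet> y = x \<bullet> A y"
proof -
  have "(y, A y) \<in> adjoint_graph D A"
    using assms by (auto simp: self_adjoint_def operator_graph_def)
  then show ?thesis using assms(2) by (auto simp: adjoint_graph_def)
qed

text \<open>Symmetry survives both limits, so \<open>(x, w)\<close> lies in the graph of the
  adjoint, and that is the graph of \<open>A\<close> itself.\<close>

lemma self_adjoint_closed:
  assumes A: "self_adjoint D A" and s: "\<And>n. s n \<in> D"
    and x: "s \<longlonglongrightarrow> x" and w: "(\<lambda>n. A (s n)) \<longlonglongrightarrow> w"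
  shows "x \<in> D \<and> A x = w"
proof -
  have "A y \<bullet> x = y \<bullet> w" if "y \<in> D" for y
  proof (rule LIMSEQ_unique)
    show "(\<lambda>n. A y \<bullet> s n) \<longlonglongrightarrow> A y \<bullet> x" by (intro tendsto_intros x)
    have "(\<lambda>n. y \<bullet> A (s n)) \<longlonglongrightarrow> y \<bullet> w" by (intro tendsto_intros w)
    then show "(\<lambda>n. A y \<bullet> s n) \<longlonglongrightarrow> y \<bullet> w"
      using self_adjoint_symmetric[OF A that s] by simp
  qed
  then have "(x, w) \<in> operator_graph D A"
    using A by (auto simp: self_adjoint_def adjoint_graph_def)
  then show ?thesis by (auto simp: operator_graph_def)
qed

lemma bounded_below_norm:
  assumes "bounded_below_by \<alpha> D A" "x \<in> D"
  shows "\<alpha> * norm x \<le> norm (A x)"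
proof (cases "x = 0")
  case False
  have "\<alpha> * norm x * norm x \<le> A x \<bullet> x"
    using assms by (simp add: bounded_below_by_def power2_eq_square mult.assoc)
  also have "\<dots> \<le> norm (A x) * norm x" by (rule norm_cauchy_schwarz)
  finally show ?thesis using False by simp
qed (simp)

text \<open>Test vectors in \<open>D\<close> may approach \<open>x\<close> itself, which turns the
  hypothesis into \<open>norm x * norm x \<le> N * norm x\<close>. It allows a norm to be bounded by
  pairings with domain elements only.\<close>

lemma inner_bound_dense:
  fixes x :: "'a::real_inner"
  assumes D: "closure D = UNIV" and le: "\<And>w. w \<in> D \<Longrightarrow> x \<bullet> w \<le> N * norm w" and "0 \<le> N"
  shows "norm x \<le> N"
proof (cases "x = 0")
  case True
  then show ?thesis using \<open>0 \<le> N\<close> by simp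
next
  case False
  have "x \<in> closure D" using D by simp
  then obtain s where s: "\<And>n. s n \<in> D" "s \<longlonglongrightarrow> x"
    unfolding closure_sequential by blast
  have "x \<bullet> x \<le> N * norm x"
    by (rule LIMSEQ_le[of "\<lambda>n. x \<bullet> s n" _ "\<lambda>n. N * norm (s n)"]) (auto intro!: tendsto_intros s le)
  then have "norm x * norm x \<le> N * norm x"
    by (simp add: power2_norm_eq_inner[symmetric] power2_eq_square)
  then show ?thesis using False by simp
qed

text \<open>
  Baire's theorem in \<open>D\<close> with the metric \<open>\<parallel>A x - A y\<parallel>\<close>, which is complete because \<open>A\<close> is closed, replaces
  the closed graph theorem; the sets \<open>{x. \<parallel>B x\<parallel> \<le> N}\<close> are closed in it by symmetry of \<open>B\<close>.
\<close>

lemma relatively_bounded: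
  fixes A B :: "'a::{real_inner, banach} \<Rightarrow> 'a"
  assumes A: "self_adjoint D A" and \<alpha>: "\<alpha> > 0" "bounded_below_by \<alpha> D A"
    and B: "self_adjoint D' B" and sub: "D \<subseteq> D'"
  shows "\<exists>K\<ge>0. \<forall>x\<in>D. norm (B x) \<le> K * norm (A x)"
proof -
  note linA = self_adjointD(1)[OF A] and linB = self_adjointD(1)[OF B]
  note sD = self_adjointD(2)[OF A]
  \<comment> \<open>Since \<open>A\<close> is bounded below, \<open>d\<close> dominates
    \<open>\<alpha>\<close> times the norm distance (\<open>dist_le\<close>); hence it separates
    points, and convergence in \<open>d\<close> implies convergence in norm.\<close>
  define d where "d = (\<lambda>x y. norm (A x - A y))"
  have dist_le: "\<alpha> * norm (x - y) \<le> d x y" if "x \<in> D" "y \<in> D" for x y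
    unfolding d_def linear_operator_diff[OF linA that, symmetric]
    by (rule bounded_below_norm[OF \<alpha>(2)]) (use that sD in \<open>auto intro: subspace_diff\<close>)
  interpret Metric_space D d
  proof
    show "d x y = 0 \<longleftrightarrow> x = y" if "x \<in> D" "y \<in> D" for x y
      using dist_le[OF that] \<alpha>(1) by (auto simp: d_def mult_le_0_iff)
    show "d x z \<le> d x y + d y z" for x y z
      unfolding d_def using norm_triangle_ineq[of "A x - A y" "A y - A z"] by simp
  qed (auto simp: d_def norm_minus_commute)
  have lim_norm: "s \<longlonglongrightarrow> x" if "\<And>n. s n \<in> D" "limitin mtopology s x sequentially" for s x
  proof -
    have x: "x \<in> D" and d0: "(\<lambda>n. d (s n) x) \<longlonglongrightarrow> 0"
      using that(2) by (auto simp: limitin_metric_dist_null)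
    have "(\<lambda>n. norm (s n - x)) \<longlonglongrightarrow> 0"
    proof (rule tendsto_sandwich[OF _ _ tendsto_const])
      show "\<forall>\<^sub>F n in sequentially. norm (s n - x) \<le> inverse \<alpha> * d (s n) x"
        using dist_le[OF that(1) x] \<alpha>(1) by (intro always_eventually) (auto simp: field_simps)
      show "(\<lambda>n. inverse \<alpha> * d (s n) x) \<longlonglongrightarrow> 0"
        by (intro tendsto_mult_right_zero d0)
    qed simp
    then show ?thesis by (simp add: LIM_zero_iff tendsto_norm_zero_iff)
  qed
  \<comment> \<open>For a \<open>d\<close>-Cauchy sequence both \<open>s n\<close> and
    \<open>A (s n)\<close> are Cauchy in norm; closedness of \<open>A\<close> identifies the two
    limits.\<close>
  have complete: "mcomplete"
    unfolding mcomplete_def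
  proof (intro allI impI)
    fix s assume "MCauchy s"
    then have s: "\<And>n. s n \<in> D"
      and C: "\<And>e. e > 0 \<Longrightarrow> \<exists>N. \<forall>n n'. N \<le> n \<longrightarrow> N \<le> n' \<longrightarrow> d (s n) (s n') < e"
      by (auto simp: MCauchy_def)
    have "Cauchy (\<lambda>n. A (s n))"
      unfolding Cauchy_def dist_norm using C by (simp add: d_def)
    then obtain w where w: "(\<lambda>n. A (s n)) \<longlonglongrightarrow> w"
      using convergent_eq_Cauchy by blast
    have "Cauchy s"
      unfolding Cauchy_def dist_norm
    proof (intro allI impI)
      fix e :: real assume "e > 0"
      then obtain N where N: "\<And>n n'. N \<le> n \<Longrightarrow> N \<le> n' \<Longrightarrow> d (s n) (s n') < \<alpha> * e"
        using C[of "\<alpha> * e"] \<alpha>(1) by auto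
      have "norm (s i - s j) < e" if "N \<le> i" "N \<le> j" for i j
        using dist_le[OF s s, of i j] N[OF that] \<alpha>(1)
        by (meson le_less_trans mult_less_cancel_left_pos)
      then show "\<exists>N. \<forall>i\<ge>N. \<forall>j\<ge>N. norm (s i - s j) < e" by blast
    qed
    then obtain x where x: "s \<longlonglongrightarrow> x"
      using convergent_eq_Cauchy by blast
    have xD: "x \<in> D" "A x = w" using self_adjoint_closed[OF A s x w] by auto
    have "(\<lambda>n. d (s n) x) \<longlonglongrightarrow> 0"
      unfolding d_def using w xD(2) by (simp add: LIM_zero_iff tendsto_norm_zero_iff)
    then show "\<exists>x. limitin mtopology s x sequentially"
      using xD(1) s by (auto simp: limitin_metric_dist_null)
  qed
  define E where "E = (\<lambda>N::nat. {x\<in>D. norm (B x) \<le> real N})"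
  have closed: "closedin mtopology (E N)" for N
    unfolding metric_closedin_iff_sequentially_closed
  proof (intro conjI allI impI)
    show "E N \<subseteq> D" by (auto simp: E_def)
    fix s x assume *: "range s \<subseteq> E N \<and> limitin mtopology s x sequentially"
    then have s: "s n \<in> D" "norm (B (s n)) \<le> real N" for n
      by (auto simp: E_def)
    have x: "x \<in> D" using * by (auto simp: limitin_metric_dist_null)
    have lim: "s \<longlonglongrightarrow> x" using lim_norm s(1) * by blast
    \<comment> \<open>\<open>B (s n)\<close> is not known to converge. Moving \<open>B\<close> onto
      a fixed \<open>w\<close> of its dense domain leaves only \<open>s n\<close>, which converges
      in norm, so the bound passes to the limit.\<close>
    have "norm (B x) \<le> real N"
    proof (rule inner_bound_dense[OF self_adjointD(3)[OF B]])
      fix w assume w: "w \<in> D'"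
      have "s n \<bullet> B w \<le> real N * norm w" for n
      proof -
        have "s n \<bullet> B w = B (s n) \<bullet> w"
          using self_adjoint_symmetric[OF B subsetD[OF sub s(1)] w] by simp
        also have "\<dots> \<le> norm (B (s n)) * norm w" by (rule norm_cauchy_schwarz)
        also have "\<dots> \<le> real N * norm w" by (intro mult_right_mono s) auto
        finally show ?thesis .
      qed
      then have "x \<bullet> B w \<le> real N * norm w"
        by (intro LIMSEQ_le_const2[of "\<lambda>n. s n \<bullet> B w"] tendsto_intros lim) auto
      then show "B x \<bullet> w \<le> real N * norm w"
        using self_adjoint_symmetric[OF B _ w] x sub by auto
    qed simp
    then show "x \<in> E N" using x by (simp add: E_def)
  qed
  have UN: "\<Union>(range E) = D"
    by (auto simp: E_def real_arch_simple)
  have "0 \<in> D" using sD by (rule subspace_0)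
  have "mtopology interior_of \<Union>(range E) = D"
    unfolding UN using interior_of_topspace[of mtopology] by simp
  then have "mtopology interior_of \<Union>(range E) \<noteq> {}" using \<open>0 \<in> D\<close> by auto
  then obtain N where "mtopology interior_of (E N) \<noteq> {}"
    using metric_Baire_category_alt[OF complete, of "range E"] closed by auto
  then obtain x0 where "x0 \<in> mtopology interior_of (E N)" by blast
  then obtain r where r: "r > 0" "mball x0 r \<subseteq> E N" and x0: "x0 \<in> D"
    using openin_interior_of[of mtopology "E N"] interior_of_subset[of mtopology "E N"]
    unfolding openin_mtopology by blast
  \<comment> \<open>The ball around \<open>x0\<close> is shifted to 0: \<open>x\<close> is the
    difference of \<open>x + x0\<close> and \<open>x0\<close>, both in \<open>E N\<close>, hence the
    factor 2.\<close>
  have small: "norm (B x) \<le> 2 * real N" if x: "x \<in> D" "norm (A x) < r" for x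
  proof -
    have xx: "x + x0 \<in> D" using x x0 sD by (auto intro: subspace_add)
    have "A (x + x0) - A x0 = A x"
      using linear_operator_diff[OF linA xx x0] by simp
    then have "d x0 (x + x0) = norm (A x)" by (simp add: d_def norm_minus_commute)
    then have "x + x0 \<in> E N" "x0 \<in> E N"
      using x x0 xx r(1) by (auto intro!: subsetD[OF r(2)])
    then have n: "norm (B (x + x0)) \<le> real N" "norm (B x0) \<le> real N" by (auto simp: E_def)
    have "B x = B (x + x0) - B x0"
      using linear_operator_diff[OF linB, of "x + x0" x0] xx x0 sub by auto
    then show ?thesis using norm_triangle_ineq4[of "B (x + x0)" "B x0"] n by simp
  qed
  have "norm (B x) \<le> (4 * real N / r) * norm (A x)" if x: "x \<in> D" for x
  proof (cases "x = 0")
    case True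
    then show ?thesis using linear_operator_zero[OF linB] r by simp
  next
    case False
    then have Ax: "norm (A x) > 0"
      using bounded_below_norm[OF \<alpha>(2) x] \<alpha>(1)
      by (metis less_le_trans mult_pos_pos zero_less_norm_iff)
    \<comment> \<open>This scaling puts \<open>c *\<^sub>R x\<close> halfway to the boundary of the
      ball of radius \<open>r\<close>; dividing by \<open>c\<close> turns \<open>2 * N\<close> into
      \<open>4 * N / r\<close>.\<close>
    define c where "c = r / (2 * norm (A x))"
    have c: "c > 0" using r Ax by (simp add: c_def)
    have "norm (A (c *\<^sub>R x)) = r / 2"
      using linA x Ax r by (simp add: linear_operator_def c_def)
    then have "norm (B (c *\<^sub>R x)) \<le> 2 * real N"
      using r x sD by (intro small) (auto intro: subspace_scale)
    moreover have "B (c *\<^sub>R x) = c *\<^sub>R B x"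
      using linB x sub by (auto simp: linear_operator_def)
    ultimately have "c * norm (B x) \<le> 2 * real N" using c by simp
    then show ?thesis using Ax r by (simp add: c_def field_simps)
  qed
  then show ?thesis using r by (intro exI[of _ "4 * real N / r"]) auto
qed

subsection \<open>Discrete Gronwall inequalities\<close>

text \<open>At an index \<open>k\<close> where \<open>s\<close> is maximal on \<open>{p..K}\<close>,
  every sum of two values of \<open>s\<close> on the right is at most \<open>2 * s k\<close>. One
  factor \<open>s k\<close> then cancels and the quadratic inequality becomes a linear one.\<close>

lemma sqrt_gronwall:
  fixes s \<gamma> :: "nat \<Rightarrow> real"
  assumes s: "\<And>k. 0 \<le> s k" and \<gamma>: "\<And>k. 0 \<le> \<gamma> k" and c: "0 \<le> c"
    and le: "\<And>k. k \<in> {p..n} \<Longrightarrow> (s k)\<^sup>2 \<le> (s p)\<^sup>2 + c * (s k + s p) + (\<Sum>i=p..<k. \<gamma> i * (s (Suc i) + s i))"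
    and K: "K \<in> {p..n}"
  shows "s K \<le> s p + 2 * c + 2 * (\<Sum>i=p..<K. \<gamma> i)"
proof -
  have "Max (s ` {p..K}) \<in> s ` {p..K}" using K by (intro Max_in) auto
  then obtain k where k: "k \<in> {p..K}" and "s k = Max (s ` {p..K})" by auto
  then have mx: "s i \<le> s k" if "i \<in> {p..K}" for i using that by auto
  have "s k \<le> s p + 2 * c + 2 * (\<Sum>i=p..<k. \<gamma> i)"
  proof (cases "s k = 0")
    case True
    then show ?thesis using s[of p] c \<gamma> by (simp add: sum_nonneg)
  next
    case False
    then have pos: "s k > 0" using s[of k] by simp
    have "s p * s p \<le> s p * s k" using mx[of p] K s[of p] by (intro mult_left_mono) auto
    moreover have "c * (s k + s p) \<le> c * (2 * s k)"
      using mx[of p] K c by (intro mult_left_mono) auto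
    moreover have "(\<Sum>i=p..<k. \<gamma> i * (s (Suc i) + s i)) \<le> (\<Sum>i=p..<k. \<gamma> i * (2 * s k))"
    proof (intro sum_mono mult_left_mono \<gamma>)
      fix i assume "i \<in> {p..<k}"
      then show "s (Suc i) + s i \<le> 2 * s k" using mx[of i] mx[of "Suc i"] k by auto
    qed
    moreover have "(\<Sum>i=p..<k. \<gamma> i * (2 * s k)) = 2 * (\<Sum>i=p..<k. \<gamma> i) * s k"
      by (simp add: sum_distrib_right[symmetric])
    moreover have "(s k)\<^sup>2 \<le> (s p)\<^sup>2 + c * (s k + s p) + (\<Sum>i=p..<k. \<gamma> i * (s (Suc i) + s i))"
      using k K by (intro le) auto
    ultimately have "s k * s k \<le> (s p + 2 * c + 2 * (\<Sum>i=p..<k. \<gamma> i)) * s k"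
      by (simp add: power2_eq_square algebra_simps)
    then show ?thesis using pos by simp
  qed
  moreover have "(\<Sum>i=p..<k. \<gamma> i) \<le> (\<Sum>i=p..<K. \<gamma> i)"
    using k \<gamma> by (intro sum_mono2) auto
  ultimately show ?thesis using mx[of K] K by auto
qed

lemma linear_gronwall:
  fixes x :: "nat \<Rightarrow> real"
  assumes "0 \<le> b" "0 \<le> g" "0 \<le> x 0"
    and step: "\<And>k. k < n \<Longrightarrow> x (Suc k) \<le> (1 + b) * x k + g"
    and "k \<le> n"
  shows "x k \<le> exp (b * k) * (x 0 + k * g)"
  using \<open>k \<le> n\<close>
proof (induction k)
  case (Suc k)
  have "x (Suc k) \<le> (1 + b) * (exp (b * k) * (x 0 + k * g)) + g"
    using step[of k] Suc \<open>0 \<le> b\<close> mult_left_mono[of "x k" "exp (b * k) * (x 0 + k * g)" "1 + b"]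
    by linarith
  \<comment> \<open>Besides \<open>1 + b \<le> exp b\<close>, the term \<open>g\<close> is inflated
    by the exponential so that the right side regains the claimed form.\<close>
  also have "\<dots> \<le> exp b * (exp (b * k) * (x 0 + k * g)) + exp (b * Suc k) * g"
  proof (intro add_mono mult_right_mono)
    show "g \<le> exp (b * Suc k) * g"
      using mult_right_mono[of 1 "exp (b * Suc k)" g] assms by simp
  qed (use assms in \<open>auto simp: exp_ge_add_one_self\<close>)
  also have "\<dots> = exp (b * Suc k) * (x 0 + Suc k * g)"
    by (simp add: exp_add algebra_simps)
  finally show ?case .
qed simp

subsection \<open>Energy stability of the split scheme\<close>

text \<open>Jensen's inequality for the square, with the weights as a probability
  distribution.\<close>

lemma sum_weighted_le_sqrt:
  fixes \<eta> a :: "'i \<Rightarrow> real"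
  assumes "finite J" "\<And>j. j \<in> J \<Longrightarrow> 0 \<le> \<eta> j" "sum \<eta> J = 1"
  shows "(\<Sum>j\<in>J. \<eta> j * a j) \<le> sqrt (\<Sum>j\<in>J. \<eta> j * (a j)\<^sup>2)"
proof -
  have "(\<Sum>j\<in>J. \<eta> j *\<^sub>R a j)\<^sup>2 \<le> (\<Sum>j\<in>J. \<eta> j * (a j)\<^sup>2)"
    using assms by (intro convex_on_sum[OF _ _ convex_power2]) auto
  then show ?thesis by (intro real_le_rsqrt) simp
qed

locale weighted_operators =
  fixes J :: "'i set" and \<eta> :: "'i \<Rightarrow> real"
    and D :: "'i \<Rightarrow> 'a::real_inner set" and A :: "'i \<Rightarrow> 'a \<Rightarrow> 'a"
  assumes finite_J: "finite J"
    and \<eta>_pos: "\<And>j. j \<in> J \<Longrightarrow> 0 < \<eta> j"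
    and \<eta>_sum: "sum \<eta> J = 1"
    and sa: "\<And>j. j \<in> J \<Longrightarrow> self_adjoint (D j) (A j)"
    and nonneg: "\<And>j x. j \<in> J \<Longrightarrow> x \<in> D j \<Longrightarrow> 0 \<le> A j x \<bullet> x"
begin

definition mean :: "('i \<Rightarrow> 'a) \<Rightarrow> 'a" where
  "mean Y = (\<Sum>j\<in>J. \<eta> j *\<^sub>R Y j)"

text \<open>With \<open>w\<close> the preceding mean, the first and last summands are discrete
  kinetic and potential energy, multiplied by \<open>\<tau>\<^sup>2\<close>. The middle one is the
  weighted variance of the components, which controls how far they drift apart.\<close>

definition energy :: "real \<Rightarrow> 'a \<Rightarrow> ('i \<Rightarrow> 'a) \<Rightarrow> real" where
  "energy \<tau> w Y = (norm (mean Y - w))\<^sup>2 + (\<Sum>j\<in>J. \<eta> j * (norm (Y j - mean Y))\<^sup>2)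
     + \<tau>\<^sup>2 * (\<Sum>j\<in>J. A j (Y j) \<bullet> Y j)"

lemma sum_\<eta>_const: "(\<Sum>j\<in>J. \<eta> j * c) = c"
  by (simp add: sum_distrib_right[symmetric] \<eta>_sum)

lemma mean_const: "mean (\<lambda>_. x) = x"
  by (simp add: mean_def scaleR_sum_left[symmetric] \<eta>_sum)

lemma mean_diff: "mean (\<lambda>j. X j - Y j) = mean X - mean Y"
  by (simp add: mean_def scaleR_diff_right sum_subtractf)

lemma mean_deviation: "(\<Sum>j\<in>J. \<eta> j *\<^sub>R (Y j - mean Y)) = 0"
  by (simp add: scaleR_diff_right sum_subtractf scaleR_sum_left[symmetric] \<eta>_sum mean_def)

lemma sum_inner_deviation: "(\<Sum>j\<in>J. \<eta> j * (x \<bullet> (Y j - mean Y))) = 0"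
  using arg_cong[OF mean_deviation[of Y], of "\<lambda>s. x \<bullet> s"] by (simp add: inner_sum_right)

lemma norm_mean_le:
  assumes "\<And>j. j \<in> J \<Longrightarrow> norm (Y j) \<le> R"
  shows "norm (mean Y) \<le> R"
proof -
  have "norm (mean Y) \<le> (\<Sum>j\<in>J. \<eta> j * R)"
    unfolding mean_def using assms \<eta>_pos by (intro sum_norm_le) (simp add: abs_of_pos)
  then show ?thesis by (simp add: sum_\<eta>_const)
qed

lemma energy_ge:
  assumes "\<And>j. j \<in> J \<Longrightarrow> Y j \<in> D j"
  shows "norm (mean Y - w) \<le> sqrt (energy \<tau> w Y)"
    and "(\<Sum>j\<in>J. \<eta> j * norm (Y j - mean Y)) \<le> sqrt (energy \<tau> w Y)"
    and "0 \<le> energy \<tau> w Y"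
proof -
  have dev: "0 \<le> (\<Sum>j\<in>J. \<eta> j * (norm (Y j - mean Y))\<^sup>2)"
    by (intro sum_nonneg mult_nonneg_nonneg less_imp_le[OF \<eta>_pos]) auto
  have op: "0 \<le> \<tau>\<^sup>2 * (\<Sum>j\<in>J. A j (Y j) \<bullet> Y j)"
    using assms nonneg by (intro mult_nonneg_nonneg sum_nonneg) auto
  show "norm (mean Y - w) \<le> sqrt (energy \<tau> w Y)"
    using dev op by (intro real_le_rsqrt) (simp add: energy_def)
  have "(\<Sum>j\<in>J. \<eta> j * norm (Y j - mean Y)) \<le> sqrt (\<Sum>j\<in>J. \<eta> j * (norm (Y j - mean Y))\<^sup>2)"
    using finite_J \<eta>_pos \<eta>_sum by (intro sum_weighted_le_sqrt) (auto intro: less_imp_le)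
  also have "\<dots> \<le> sqrt (energy \<tau> w Y)"
    using op by (simp add: energy_def)
  finally show "(\<Sum>j\<in>J. \<eta> j * norm (Y j - mean Y)) \<le> sqrt (energy \<tau> w Y)" .
  show "0 \<le> energy \<tau> w Y" using dev op by (simp add: energy_def)
qed

text \<open>The \<open>j\<close>-th equation is paired with \<open>Y j - X j\<close> and doubled.
  With \<open>d'\<close>, \<open>d\<close> the increments of the mean and \<open>e\<close>,
  \<open>g\<close> the deviations from it, the second difference is \<open>d' - d + e j\<close> and
  the test vector is \<open>d' + e j - g j\<close>.\<close>

lemma energy_step:
  assumes Y: "\<And>j. j \<in> J \<Longrightarrow> Y j \<in> D j" and X: "\<And>j. j \<in> J \<Longrightarrow> X j \<in> D j"
    and eq: "\<And>j. j \<in> J \<Longrightarrow>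
      \<eta> j *\<^sub>R (Y j - 2 *\<^sub>R mean X + w) + \<tau>\<^sup>2 *\<^sub>R A j (Y j) = (\<tau>\<^sup>2 * \<eta> j) *\<^sub>R F j"
  shows "energy \<tau> (mean X) Y \<le> energy \<tau> w X + 2 * \<tau>\<^sup>2 * (\<Sum>j\<in>J. \<eta> j * (F j \<bullet> (Y j - X j)))"
proof -
  define d' d where "d' = mean Y - mean X" and "d = mean X - w"
  define e g where "e = (\<lambda>j. Y j - mean Y)" and "g = (\<lambda>j. X j - mean X)"
  \<comment> \<open>By symmetry of \<open>A j\<close>, the right side minus the left side is the
    quadratic form of \<open>A j\<close> at \<open>Y j - X j\<close>.\<close>
  have op: "A j (Y j) \<bullet> Y j - A j (X j) \<bullet> X j \<le> 2 * (A j (Y j) \<bullet> (Y j - X j))" if j: "j \<in> J" for j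
  proof -
    have "Y j - X j \<in> D j"
      using X[OF j] Y[OF j] self_adjointD(2)[OF sa[OF j]] by (auto intro: subspace_diff)
    then have "0 \<le> A j (Y j - X j) \<bullet> (Y j - X j)" using nonneg[OF j] by blast
    then have "0 \<le> (A j (Y j) - A j (X j)) \<bullet> (Y j - X j)"
      using linear_operator_diff[OF self_adjointD(1)[OF sa[OF j]] Y[OF j] X[OF j]] by simp
    moreover have "A j (X j) \<bullet> Y j = A j (Y j) \<bullet> X j"
      using self_adjoint_symmetric[OF sa[OF j] X[OF j] Y[OF j]] by (simp add: inner_commute)
    ultimately show ?thesis by (simp add: algebra_simps)
  qed
  have local: "\<eta> j * ((norm d')\<^sup>2 - (norm d)\<^sup>2) + \<eta> j * (norm (e j))\<^sup>2 - \<eta> j * (norm (g j))\<^sup>2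
      + 2 * (\<eta> j * ((d' - d) \<bullet> e j)) - 2 * (\<eta> j * ((d' - d) \<bullet> g j)) + 2 * (\<eta> j * (d' \<bullet> e j))
      + \<tau>\<^sup>2 * (A j (Y j) \<bullet> Y j) - \<tau>\<^sup>2 * (A j (X j) \<bullet> X j)
      \<le> 2 * \<tau>\<^sup>2 * (\<eta> j * (F j \<bullet> (Y j - X j)))" if j: "j \<in> J" for j
  proof -
    have *: "Y j - 2 *\<^sub>R mean X + w = d' - d + e j" "Y j - X j = d' + e j - g j"
      by (simp_all add: d'_def d_def e_def g_def scaleR_2)
    have "(norm d')\<^sup>2 - (norm d)\<^sup>2 + (norm (e j))\<^sup>2 - (norm (g j))\<^sup>2
        + 2 * ((d' - d) \<bullet> e j) - 2 * ((d' - d) \<bullet> g j) + 2 * (d' \<bullet> e j)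
        + (norm (d' - d))\<^sup>2 + (norm (e j - g j))\<^sup>2
        = 2 * ((d' - d + e j) \<bullet> (d' + e j - g j))"
      by (simp add: power2_norm_eq_inner inner_commute algebra_simps)
    then have "(norm d')\<^sup>2 - (norm d)\<^sup>2 + (norm (e j))\<^sup>2 - (norm (g j))\<^sup>2
        + 2 * ((d' - d) \<bullet> e j) - 2 * ((d' - d) \<bullet> g j) + 2 * (d' \<bullet> e j)
        \<le> 2 * ((d' - d + e j) \<bullet> (d' + e j - g j))"
      \<comment> \<open>The two squares are dropped; the remaining cross terms have no sign and are
        kept for the summation.\<close>
      using zero_le_power2[of "norm (d' - d)"] zero_le_power2[of "norm (e j - g j)"] by linarith
    then have 1: "\<eta> j * ((norm d')\<^sup>2 - (norm d)\<^sup>2 + (norm (e j))\<^sup>2 - (norm (g j))\<^sup>2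
        + 2 * ((d' - d) \<bullet> e j) - 2 * ((d' - d) \<bullet> g j) + 2 * (d' \<bullet> e j))
        \<le> \<eta> j * (2 * ((d' - d + e j) \<bullet> (Y j - X j)))"
      unfolding * using \<eta>_pos[OF j] by (intro mult_left_mono) auto
    have 2: "\<tau>\<^sup>2 * (A j (Y j) \<bullet> Y j - A j (X j) \<bullet> X j) \<le> \<tau>\<^sup>2 * (2 * (A j (Y j) \<bullet> (Y j - X j)))"
      using op[OF j] by (intro mult_left_mono) auto
    have 3: "\<eta> j * ((d' - d + e j) \<bullet> (Y j - X j)) + \<tau>\<^sup>2 * (A j (Y j) \<bullet> (Y j - X j))
        = \<tau>\<^sup>2 * \<eta> j * (F j \<bullet> (Y j - X j))"
      using arg_cong[OF eq[OF j, unfolded *(1)], of "\<lambda>s. s \<bullet> (Y j - X j)"]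
      by (simp add: inner_add_left)
    show ?thesis using 1 2 3 by (simp add: algebra_simps)
  qed
  \<comment> \<open>Each cross term pairs a deviation \<open>e j\<close> or \<open>g j\<close> with
    a vector independent of \<open>j\<close>, so its weighted sum vanishes by
    \<open>sum_inner_deviation\<close>.\<close>
  have "(\<Sum>j\<in>J. \<eta> j * ((norm d')\<^sup>2 - (norm d)\<^sup>2) + \<eta> j * (norm (e j))\<^sup>2 - \<eta> j * (norm (g j))\<^sup>2
      + 2 * (\<eta> j * ((d' - d) \<bullet> e j)) - 2 * (\<eta> j * ((d' - d) \<bullet> g j)) + 2 * (\<eta> j * (d' \<bullet> e j))
      + \<tau>\<^sup>2 * (A j (Y j) \<bullet> Y j) - \<tau>\<^sup>2 * (A j (X j) \<bullet> X j))
      \<le> (\<Sum>j\<in>J. 2 * \<tau>\<^sup>2 * (\<eta> j * (F j \<bullet> (Y j - X j))))"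
    by (intro sum_mono local)
  then show ?thesis
    unfolding sum.distrib sum_subtractf sum_distrib_left[symmetric] sum_\<eta>_const
    unfolding e_def g_def sum_inner_deviation
    by (simp add: energy_def d'_def d_def sum_distrib_left[symmetric] algebra_simps)
qed

text \<open>
  Covers the first step, where the energy inequality does not apply: \<open>z\<^sub>1\<close> is not the mean of
  elements of the domains.
\<close>

lemma initial_energy:
  assumes Y: "\<And>j. j \<in> J \<Longrightarrow> Y j \<in> D j"
    and eq: "\<And>j. j \<in> J \<Longrightarrow> \<eta> j *\<^sub>R Y j + \<tau>\<^sup>2 *\<^sub>R A j (Y j) = \<eta> j *\<^sub>R G j"
    and G: "\<And>j. j \<in> J \<Longrightarrow> norm (G j) \<le> R" and w: "norm w \<le> R"
  shows "energy \<tau> w Y \<le> (3 * R)\<^sup>2"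
proof -
  have R: "0 \<le> R" using w norm_ge_zero order_trans by blast
  \<comment> \<open>The equation is tested with \<open>Y j\<close> itself. The operator term is
    nonnegative, so one factor \<open>norm (Y j)\<close> cancels; the bound obtained is fed back to
    control the operator term.\<close>
  have both: "norm (Y j) \<le> R \<and> \<tau>\<^sup>2 * (A j (Y j) \<bullet> Y j) \<le> \<eta> j * R\<^sup>2" if j: "j \<in> J" for j
  proof -
    have op: "0 \<le> \<tau>\<^sup>2 * (A j (Y j) \<bullet> Y j)" using nonneg[OF j Y[OF j]] by simp
    have "\<eta> j * (norm (Y j))\<^sup>2 + \<tau>\<^sup>2 * (A j (Y j) \<bullet> Y j) = \<eta> j * (G j \<bullet> Y j)"
      using arg_cong[OF eq[OF j], of "\<lambda>s. s \<bullet> Y j"]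
      by (simp add: inner_add_left power2_norm_eq_inner)
    also have "G j \<bullet> Y j \<le> R * norm (Y j)"
      using norm_cauchy_schwarz[of "G j" "Y j"] mult_right_mono[OF G[OF j], of "norm (Y j)"] by simp
    finally have le: "\<eta> j * (norm (Y j))\<^sup>2 + \<tau>\<^sup>2 * (A j (Y j) \<bullet> Y j) \<le> \<eta> j * (R * norm (Y j))"
      using \<eta>_pos[OF j] by (simp add: mult_left_mono)
    then have "\<eta> j * (norm (Y j) * norm (Y j)) \<le> \<eta> j * (R * norm (Y j))"
      using op by (simp add: power2_eq_square)
    then have "norm (Y j) * norm (Y j) \<le> R * norm (Y j)"
      using \<eta>_pos[OF j] by simp
    then have YR: "norm (Y j) \<le> R" using R by (cases "Y j = 0") auto
    have "\<eta> j * (R * norm (Y j)) \<le> \<eta> j * R\<^sup>2"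
      using YR R \<eta>_pos[OF j] by (simp add: power2_eq_square mult_left_mono)
    moreover have "0 \<le> \<eta> j * (norm (Y j))\<^sup>2" using \<eta>_pos[OF j] by simp
    ultimately show ?thesis using le YR by linarith
  qed
  have m: "norm (mean Y) \<le> R" using both by (intro norm_mean_le) auto
  have "(norm (mean Y - w))\<^sup>2 \<le> (2 * R)\<^sup>2"
    using norm_triangle_ineq4[of "mean Y" w] m w by (intro power_mono) auto
  moreover have "(\<Sum>j\<in>J. \<eta> j * (norm (Y j - mean Y))\<^sup>2) \<le> (\<Sum>j\<in>J. \<eta> j * (2 * R)\<^sup>2)"
  proof (intro sum_mono mult_left_mono power_mono)
    fix j assume j: "j \<in> J"
    show "norm (Y j - mean Y) \<le> 2 * R"
      using norm_triangle_ineq4[of "Y j" "mean Y"] m both[OF j] by simp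
    show "0 \<le> \<eta> j" using \<eta>_pos[OF j] by simp
  qed simp
  moreover have "\<tau>\<^sup>2 * (\<Sum>j\<in>J. A j (Y j) \<bullet> Y j) \<le> (\<Sum>j\<in>J. \<eta> j * R\<^sup>2)"
    unfolding sum_distrib_left using both by (intro sum_mono) auto
  \<comment> \<open>The three summands of the energy are at most 4, 4 and 1 times
    \<open>R\<^sup>2\<close>, whence the factor 3 in the claim.\<close>
  ultimately show ?thesis
    unfolding energy_def sum_\<eta>_const by (simp add: power2_eq_square)
qed

lemma abs_sum_inner_le:
  assumes "\<And>j. j \<in> J \<Longrightarrow> norm (F j) \<le> b"
  shows "\<bar>\<Sum>j\<in>J. \<eta> j * (F j \<bullet> X j)\<bar> \<le> b * (\<Sum>j\<in>J. \<eta> j * norm (X j))"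
proof -
  have "\<bar>\<Sum>j\<in>J. \<eta> j * (F j \<bullet> X j)\<bar> \<le> (\<Sum>j\<in>J. \<bar>\<eta> j * (F j \<bullet> X j)\<bar>)" by (rule sum_abs)
  also have "\<dots> \<le> (\<Sum>j\<in>J. \<eta> j * (b * norm (X j)))"
  proof (intro sum_mono)
    fix j assume j: "j \<in> J"
    have "\<bar>F j \<bullet> X j\<bar> \<le> norm (F j) * norm (X j)" by (rule Cauchy_Schwarz_ineq2)
    also have "\<dots> \<le> b * norm (X j)" using assms[OF j] by (intro mult_right_mono) auto
    finally show "\<bar>\<eta> j * (F j \<bullet> X j)\<bar> \<le> \<eta> j * (b * norm (X j))"
      using \<eta>_pos[OF j] by (simp add: abs_mult abs_of_pos)
  qed
  finally show ?thesis by (simp add: sum_distrib_left algebra_simps)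
qed

text \<open>In \<open>G\<close>, the first summand comes from the first step, 4 from the boundary
  terms of the summation by parts, and \<open>8 * T\<close> from the accumulated residuals of size
  \<open>h\<close>. The exponential comes from the Gronwall bound for the accumulated error
  \<open>z\<close>.\<close>

definition stability_const :: "real \<Rightarrow> real \<Rightarrow> real" where
  "stability_const T L =
     (let G = 3 * (3 + T + L * T\<^sup>2) + 4 + 8 * T
      in G + 8 * L * T * (exp (8 * L * T * T) * (T + T * G)))"

text \<open>A single \<open>h\<close> measures all data errors. The balanced residual
  \<open>q\<close> may be as large as \<open>h / \<tau>\<close>: after summation by parts it enters
  only through boundary terms weighted by \<open>\<tau>\<^sup>2\<close> and through its one-step
  increments, which are at most \<open>h\<close>.\<close>

lemma stability:
  fixes z :: "nat \<Rightarrow> 'a" and Y q \<epsilon> :: "nat \<Rightarrow> 'i \<Rightarrow> 'a"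
  assumes \<tau>: "0 < \<tau>" "real n * \<tau> \<le> T" and L: "0 \<le> L" and h: "0 \<le> h"
    and Y: "\<And>k j. k \<in> {2..n} \<Longrightarrow> j \<in> J \<Longrightarrow> Y k j \<in> D j"
    and z: "z 0 = 0" "norm (z 1) \<le> \<tau> * h" "\<And>k. k \<in> {2..n} \<Longrightarrow> z k = mean (Y k)"
    and eq: "\<And>k j. k \<in> {1..<n} \<Longrightarrow> j \<in> J \<Longrightarrow>
      \<eta> j *\<^sub>R (Y (Suc k) j - 2 *\<^sub>R z k + z (k - 1)) + \<tau>\<^sup>2 *\<^sub>R A j (Y (Suc k) j)
        = (\<tau>\<^sup>2 * \<eta> j) *\<^sub>R (q (Suc k) j + \<epsilon> k j)"
    and balanced: "\<And>k. k \<in> {2..n} \<Longrightarrow> mean (q k) = 0"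
    and q_bound: "\<And>k j. k \<in> {2..n} \<Longrightarrow> j \<in> J \<Longrightarrow> \<tau> * norm (q k j) \<le> h"
    and q_diff: "\<And>k j. k \<in> {2..<n} \<Longrightarrow> j \<in> J \<Longrightarrow> norm (q (Suc k) j - q k j) \<le> h"
    and \<epsilon>_bound: "\<And>k j. k \<in> {1..<n} \<Longrightarrow> j \<in> J \<Longrightarrow> norm (\<epsilon> k j) \<le> h + L * norm (z k)"
    and K: "K \<in> {1..<n}"
  shows "norm (z (Suc K) - z K) \<le> \<tau> * h * stability_const T L"
proof -
  have n: "2 \<le> n" using K by auto
  have "1 * \<tau> \<le> real n * \<tau>" using \<tau> n by (intro mult_right_mono) auto
  then have T: "\<tau> \<le> T" "0 < T" using \<tau> by linarith+
  define E where "E k = energy \<tau> (z (k - 1)) (Y k)" for k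
  \<comment> \<open>The energy makes sense from index 2 on, where \<open>z\<close> is a mean. The
    default 0 keeps \<open>s\<close> nonnegative at every index, as \<open>sqrt_gronwall\<close>
    requires.\<close>
  define s where "s k = (if k \<in> {2..n} then sqrt (E k) else 0)" for k
  define e where "e k j = Y k j - mean (Y k)" for k j
  define \<Phi> where "\<Phi> k = (\<Sum>j\<in>J. \<eta> j * (q k j \<bullet> e k j))" for k
  define \<gamma> where "\<gamma> k = 4 * \<tau>\<^sup>2 * (h + L * norm (z k))" for k
  have \<gamma>: "0 \<le> \<gamma> k" for k using h L by (simp add: \<gamma>_def)
  have E0: "0 \<le> E k" if "k \<in> {2..n}" for k
    unfolding E_def using energy_ge(3) Y that by blast
  have s: "0 \<le> s k" for k using E0 by (simp add: s_def)
  have s2: "(s k)\<^sup>2 = E k" if "k \<in> {2..n}" for k using E0[OF that] that by (simp add: s_def)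
  have z_diff: "norm (z k - z (k - 1)) \<le> s k" if "k \<in> {2..n}" for k
    unfolding s_def E_def using energy_ge(1)[of "Y k" "z (k - 1)" \<tau>] Y that z(3)[OF that] by simp
  have e_sum: "(\<Sum>j\<in>J. \<eta> j * norm (e k j)) \<le> s k" if "k \<in> {2..n}" for k
    unfolding s_def E_def e_def using energy_ge(2)[of "Y k" \<tau> "z (k - 1)"] Y that by simp
  have \<Phi>_bound: "\<tau> * \<bar>\<Phi> k\<bar> \<le> h * s k" if k: "k \<in> {2..n}" for k
  proof -
    have "\<bar>\<Phi> k\<bar> \<le> (h / \<tau>) * (\<Sum>j\<in>J. \<eta> j * norm (e k j))"
      unfolding \<Phi>_def using q_bound[OF k] \<tau> by (intro abs_sum_inner_le) (simp add: field_simps)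
    also have "\<dots> \<le> (h / \<tau>) * s k" using e_sum[OF k] \<tau> h by (intro mult_left_mono) auto
    finally show ?thesis using \<tau> by (simp add: field_simps)
  qed
  have balanced': "(\<Sum>j\<in>J. \<eta> j * (q k j \<bullet> x)) = 0" if "k \<in> {2..n}" for k x
    using arg_cong[OF balanced[OF that], of "\<lambda>s. s \<bullet> x"] by (simp add: mean_def inner_sum_left)
  \<comment> \<open>The corrected energy \<open>E k - 2 * \<tau>\<^sup>2 * \<Phi> k\<close> is the
    quantity that grows slowly: subtracting \<Phi> absorbs the part of \<open>q\<close> that is not
    small.\<close>
  have E_step: "E (Suc k) - 2 * \<tau>\<^sup>2 * \<Phi> (Suc k) \<le> E k - 2 * \<tau>\<^sup>2 * \<Phi> k + \<gamma> k * (s (Suc k) + s k)"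
    if k: "k \<in> {2..<n}" for k
  proof -
    have k': "k \<in> {2..n}" "Suc k \<in> {2..n}" "k \<in> {1..<n}" using k by auto
    have zk: "z k = mean (Y k)" "z (Suc k) = mean (Y (Suc k))" using z(3) k' by auto
    define S1 S2 where "S1 = (\<Sum>j\<in>J. \<eta> j * ((q (Suc k) j - q k j) \<bullet> e k j))"
      and "S2 = (\<Sum>j\<in>J. \<eta> j * (\<epsilon> k j \<bullet> (Y (Suc k) j - Y k j)))"
    have "E (Suc k) \<le> E k + 2 * \<tau>\<^sup>2 * (\<Sum>j\<in>J. \<eta> j * ((q (Suc k) j + \<epsilon> k j) \<bullet> (Y (Suc k) j - Y k j)))"
      unfolding E_def diff_Suc_1 zk(1)
      using eq[OF k'(3)] Y[OF k'(1)] Y[OF k'(2)] by (intro energy_step) (auto simp: zk)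
    \<comment> \<open>The increment of \<open>Y\<close> is that of \<open>z\<close> plus
      \<open>e (Suc k) j - e k j\<close>. Balance removes the first part, and the second is summed
      by parts.\<close>
    also have "(\<Sum>j\<in>J. \<eta> j * ((q (Suc k) j + \<epsilon> k j) \<bullet> (Y (Suc k) j - Y k j)))
        = (\<Sum>j\<in>J. \<eta> j * (q (Suc k) j \<bullet> (z (Suc k) - z k)) + \<eta> j * (q (Suc k) j \<bullet> e (Suc k) j)
            - \<eta> j * (q k j \<bullet> e k j) - \<eta> j * ((q (Suc k) j - q k j) \<bullet> e k j)
            + \<eta> j * (\<epsilon> k j \<bullet> (Y (Suc k) j - Y k j)))"
      by (intro sum.cong) (auto simp: e_def zk algebra_simps)
    also have "\<dots> = \<Phi> (Suc k) - \<Phi> k - S1 + S2"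
      by (simp add: sum.distrib sum_subtractf balanced'[OF k'(2)] \<Phi>_def S1_def S2_def)
    finally have 1: "E (Suc k) \<le> E k + 2 * \<tau>\<^sup>2 * (\<Phi> (Suc k) - \<Phi> k - S1 + S2)" .
    have "\<bar>S1\<bar> \<le> h * (\<Sum>j\<in>J. \<eta> j * norm (e k j))"
      unfolding S1_def using q_diff[OF k] by (intro abs_sum_inner_le)
    also have "\<dots> \<le> h * s k" using e_sum[OF k'(1)] h by (intro mult_left_mono)
    finally have S1: "\<bar>S1\<bar> \<le> h * s k" .
    have "(\<Sum>j\<in>J. \<eta> j * norm (Y (Suc k) j - Y k j))
        \<le> (\<Sum>j\<in>J. \<eta> j * norm (z (Suc k) - z k) + \<eta> j * norm (e (Suc k) j) + \<eta> j * norm (e k j))"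
    proof (intro sum_mono)
      fix j assume j: "j \<in> J"
      have eq: "Y (Suc k) j - Y k j = (z (Suc k) - z k) + e (Suc k) j - e k j"
        by (simp add: e_def zk)
      have "norm (Y (Suc k) j - Y k j) \<le> norm (z (Suc k) - z k) + norm (e (Suc k) j) + norm (e k j)"
        unfolding eq using norm_triangle_ineq4[of "z (Suc k) - z k + e (Suc k) j" "e k j"]
          norm_triangle_ineq[of "z (Suc k) - z k" "e (Suc k) j"] by linarith
      then show "\<eta> j * norm (Y (Suc k) j - Y k j)
          \<le> \<eta> j * norm (z (Suc k) - z k) + \<eta> j * norm (e (Suc k) j) + \<eta> j * norm (e k j)"
        using \<eta>_pos[OF j] by (simp add: distrib_left[symmetric])
    qed
    also have "\<dots> \<le> 2 * s (Suc k) + s k"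
      unfolding sum.distrib sum_\<eta>_const
      using z_diff[OF k'(2)] e_sum[OF k'(1)] e_sum[OF k'(2)] by simp
    finally have Y_sum: "(\<Sum>j\<in>J. \<eta> j * norm (Y (Suc k) j - Y k j)) \<le> 2 * s (Suc k) + s k" .
    have "\<bar>S2\<bar> \<le> (h + L * norm (z k)) * (\<Sum>j\<in>J. \<eta> j * norm (Y (Suc k) j - Y k j))"
      unfolding S2_def using \<epsilon>_bound[OF k'(3)] by (intro abs_sum_inner_le)
    also have "\<dots> \<le> (h + L * norm (z k)) * (2 * s (Suc k) + s k)"
      using Y_sum h L by (intro mult_left_mono) auto
    finally have S2: "\<bar>S2\<bar> \<le> (h + L * norm (z k)) * (2 * s (Suc k) + s k)" .
    have "- S1 + S2 \<le> h * s k + (h + L * norm (z k)) * (2 * s (Suc k) + s k)"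
      using S1 S2 by linarith
    also have "\<dots> \<le> 2 * (h + L * norm (z k)) * (s (Suc k) + s k)"
    proof -
      have "0 \<le> L * norm (z k) * s k" using L s[of k] by simp
      then show ?thesis by (simp add: algebra_simps)
    qed
    finally have "2 * \<tau>\<^sup>2 * (- S1 + S2) \<le> 2 * \<tau>\<^sup>2 * (2 * (h + L * norm (z k)) * (s (Suc k) + s k))"
      by (intro mult_left_mono) auto
    then have "2 * \<tau>\<^sup>2 * (- S1 + S2) \<le> \<gamma> k * (s (Suc k) + s k)"
      by (simp add: \<gamma>_def algebra_simps)
    then show ?thesis using 1 by (simp add: algebra_simps)
  qed
  have summed: "E k - 2 * \<tau>\<^sup>2 * \<Phi> k \<le> E 2 - 2 * \<tau>\<^sup>2 * \<Phi> 2 + (\<Sum>i=2..<k. \<gamma> i * (s (Suc i) + s i))"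
    if "2 \<le> k" "k \<le> n" for k
    using that
  proof (induction k rule: dec_induct)
    case (step k)
    then show ?case using E_step[of k] by simp
  qed simp
  \<comment> \<open>The boundary terms \<Phi> are of order \<open>h / \<tau>\<close> times
    \<open>s\<close>; the factor \<open>2 * \<tau>\<^sup>2\<close> leaves the constant
    \<open>2 * \<tau> * h\<close> needed for \<open>sqrt_gronwall\<close>.\<close>
  have s_sq: "(s k)\<^sup>2 \<le> (s 2)\<^sup>2 + 2 * \<tau> * h * (s k + s 2) + (\<Sum>i=2..<k. \<gamma> i * (s (Suc i) + s i))"
    if k: "k \<in> {2..n}" for k
  proof -
    have "2 * \<tau>\<^sup>2 * \<Phi> k - 2 * \<tau>\<^sup>2 * \<Phi> 2 \<le> 2 * \<tau> * (\<tau> * \<bar>\<Phi> k\<bar> + \<tau> * \<bar>\<Phi> 2\<bar>)"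
    proof -
      have "\<Phi> k - \<Phi> 2 \<le> \<bar>\<Phi> k\<bar> + \<bar>\<Phi> 2\<bar>" by linarith
      then have "2 * \<tau>\<^sup>2 * (\<Phi> k - \<Phi> 2) \<le> 2 * \<tau>\<^sup>2 * (\<bar>\<Phi> k\<bar> + \<bar>\<Phi> 2\<bar>)" by (intro mult_left_mono) auto
      then show ?thesis by (simp add: power2_eq_square algebra_simps)
    qed
    also have "\<dots> \<le> 2 * \<tau> * (h * s k + h * s 2)"
      using \<Phi>_bound[OF k] \<Phi>_bound[of 2] n \<tau> by (intro mult_left_mono add_mono) auto
    finally show ?thesis
      using summed[of k] k s2[OF k] s2[of 2] n by (simp add: algebra_simps)
  qed
  \<comment> \<open>Of the 3, two units come from \<open>2 *\<^sub>R z 1\<close> and one from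
    \<open>q\<close>; \<open>T + L * T\<^sup>2\<close> comes from \<open>\<epsilon>\<close>, using
    \<open>\<tau> \<le> T\<close>.\<close>
  define c1 where "c1 = 3 + T + L * T\<^sup>2"
  have c1: "1 \<le> c1" using T L by (simp add: c1_def)
  have "E 2 \<le> (3 * (\<tau> * h * c1))\<^sup>2"
    unfolding E_def
  \<comment> \<open>As \<open>z 0 = 0\<close>, the error equation at index 1 has the form required
    there once \<open>2 *\<^sub>R z 1\<close> is moved to the right side.\<close>
  proof (rule initial_energy[where G = "\<lambda>j. 2 *\<^sub>R z 1 + \<tau>\<^sup>2 *\<^sub>R (q 2 j + \<epsilon> 1 j)"])
    have one: "1 \<in> {1..<n}" "2 \<in> {2..n}" using n by auto
    show "Y 2 j \<in> D j" if "j \<in> J" for j using Y[OF one(2) that] .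
    have "\<tau> * h * 1 \<le> \<tau> * h * c1" using c1 \<tau> h by (intro mult_left_mono) auto
    then show "norm (z (2 - 1)) \<le> \<tau> * h * c1" using z(2) by simp
    fix j assume j: "j \<in> J"
    show "\<eta> j *\<^sub>R Y 2 j + \<tau>\<^sup>2 *\<^sub>R A j (Y 2 j) = \<eta> j *\<^sub>R (2 *\<^sub>R z 1 + \<tau>\<^sup>2 *\<^sub>R (q 2 j + \<epsilon> 1 j))"
      using eq[OF one(1) j] z(1) by (simp add: numeral_2_eq_2 algebra_simps)
    have "L * norm (z 1) \<le> L * (T * h)"
      using z(2) L h T by (intro mult_left_mono order_trans[OF z(2)] mult_right_mono) auto
    then have "norm (\<epsilon> 1 j) \<le> h + L * (T * h)" using \<epsilon>_bound[OF one(1) j] by simp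
    then have "\<tau> * norm (\<epsilon> 1 j) \<le> T * (h + L * (T * h))"
      using T \<tau> by (intro mult_mono) auto
    then have "\<tau> * norm (q 2 j + \<epsilon> 1 j) \<le> h + T * (h + L * (T * h))"
      using q_bound[OF one(2) j] mult_left_mono[OF norm_triangle_ineq[of "q 2 j" "\<epsilon> 1 j"], of \<tau>] \<tau>
      by (simp add: distrib_left)
    then have "\<tau> * (\<tau> * norm (q 2 j + \<epsilon> 1 j)) \<le> \<tau> * (h + T * (h + L * (T * h)))"
      using \<tau> by (intro mult_left_mono) auto
    then have "norm (2 *\<^sub>R z 1) + norm (\<tau>\<^sup>2 *\<^sub>R (q 2 j + \<epsilon> 1 j))
        \<le> 2 * (\<tau> * h) + \<tau> * (h + T * (h + L * (T * h)))"
      using z(2) by (simp add: power2_eq_square)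
    also have "\<dots> = \<tau> * h * c1" by (simp add: c1_def power2_eq_square algebra_simps)
    finally show "norm (2 *\<^sub>R z 1 + \<tau>\<^sup>2 *\<^sub>R (q 2 j + \<epsilon> 1 j)) \<le> \<tau> * h * c1"
      using norm_triangle_ineq order_trans by blast
  qed
  then have start: "s 2 \<le> 3 * (\<tau> * h * c1)"
    using \<tau> h c1 n by (auto simp: s_def intro!: real_le_lsqrt)
  \<comment> \<open>A nondecreasing majorant of \<open>norm (z k)\<close>, so that it can be pulled
    out of the sum of the weights \<gamma>.\<close>
  define \<zeta> where "\<zeta> k = \<tau> * h + (\<Sum>i=2..k. s i)" for k
  have \<zeta>_mono: "\<zeta> i \<le> \<zeta> k" if "i \<le> k" for i k
    unfolding \<zeta>_def using that s by (intro add_left_mono sum_mono2) auto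
  have \<zeta>_nonneg: "0 \<le> \<zeta> k" for k
    unfolding \<zeta>_def using \<tau> h s by (intro add_nonneg_nonneg sum_nonneg) auto
  have z_le: "norm (z k) \<le> \<zeta> k" if "1 \<le> k" "k \<le> n" for k
    using that
  proof (induction k rule: dec_induct)
    case base
    then show ?case using z(2) by (simp add: \<zeta>_def)
  next
    case (step k)
    have "norm (z (Suc k)) \<le> norm (z k) + norm (z (Suc k) - z k)"
      using norm_triangle_sub[of "z (Suc k)" "z k"] by simp
    then show ?case using step z_diff[of "Suc k"] by (simp add: \<zeta>_def)
  qed
  define G where "G = 3 * c1 + 4 + 8 * T"
  have G: "0 \<le> G" using c1 T by (simp add: G_def)
  \<comment> \<open>Only \<gamma> at indices below \<open>k\<close> enters, hence
    \<open>\<zeta> (k - 1)\<close> on the right: the estimate is explicit in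
    \<open>k\<close>.\<close>
  have s_le: "s k \<le> \<tau> * h * G + 8 * L * T * \<tau> * \<zeta> (k - 1)" if k: "k \<in> {2..n}" for k
  proof -
    have "(\<Sum>i=2..<k. \<gamma> i) \<le> (\<Sum>i=2..<k. 4 * \<tau>\<^sup>2 * (h + L * \<zeta> (k - 1)))"
    proof (intro sum_mono)
      fix i assume i: "i \<in> {2..<k}"
      have "norm (z i) \<le> \<zeta> i" using i k by (intro z_le) auto
      also have "\<dots> \<le> \<zeta> (k - 1)" using i by (intro \<zeta>_mono) auto
      finally have "norm (z i) \<le> \<zeta> (k - 1)" .
      then show "\<gamma> i \<le> 4 * \<tau>\<^sup>2 * (h + L * \<zeta> (k - 1))"
        unfolding \<gamma>_def using L by (intro mult_left_mono add_left_mono) auto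
    qed
    also have "\<dots> = (real (k - 2) * \<tau>) * (4 * \<tau> * (h + L * \<zeta> (k - 1)))"
      by (simp add: power2_eq_square)
    also have "\<dots> \<le> T * (4 * \<tau> * (h + L * \<zeta> (k - 1)))"
    proof (rule mult_right_mono)
      have "real (k - 2) * \<tau> \<le> real n * \<tau>" using k \<tau> by (intro mult_right_mono) auto
      then show "real (k - 2) * \<tau> \<le> T" using \<tau>(2) by linarith
      show "0 \<le> 4 * \<tau> * (h + L * \<zeta> (k - 1))" using \<tau> h L \<zeta>_nonneg by simp
    qed
    finally have "(\<Sum>i=2..<k. \<gamma> i) \<le> T * (4 * \<tau> * (h + L * \<zeta> (k - 1)))" .
    moreover have "s k \<le> s 2 + 2 * (2 * \<tau> * h) + 2 * (\<Sum>i=2..<k. \<gamma> i)"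
      using \<tau> h by (intro sqrt_gronwall[OF s \<gamma> _ s_sq k]) auto
    ultimately have "s k \<le> s 2 + 2 * (2 * \<tau> * h) + 2 * (T * (4 * \<tau> * (h + L * \<zeta> (k - 1))))" by simp
    then show ?thesis using start by (simp add: G_def algebra_simps)
  qed
  have \<zeta>_le: "\<zeta> (Suc k) \<le> exp (8 * L * T * T) * (T * h + T * h * G)" if k: "k < n" for k
  proof -
    have b: "0 \<le> 8 * L * T * \<tau>" "0 \<le> \<tau> * h * G" using L T \<tau> h G by auto
    have kT: "real k * \<tau> \<le> T"
      using k \<tau>(1) by (intro order_trans[OF mult_right_mono \<tau>(2)]) auto
    have "\<zeta> (Suc k) \<le> exp (8 * L * T * \<tau> * k) * (\<zeta> (Suc 0) + k * (\<tau> * h * G))"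
    \<comment> \<open>The index is shifted by one so that the recursion starts from
      \<open>\<zeta> 1 = \<tau> * h\<close>. The resulting bound is only of order \<open>h\<close>;
      the missing factor \<tau> is supplied by \<open>s_le\<close>.\<close>
    proof (rule linear_gronwall[where x = "\<lambda>k. \<zeta> (Suc k)" and n = k, OF b \<zeta>_nonneg])
      fix i assume "i < k"
      then show "\<zeta> (Suc (Suc i)) \<le> (1 + 8 * L * T * \<tau>) * \<zeta> (Suc i) + \<tau> * h * G"
        using s_le[of "Suc (Suc i)"] k by (simp add: \<zeta>_def algebra_simps)
    qed simp
    also have "\<zeta> (Suc 0) = \<tau> * h" by (simp add: \<zeta>_def)
    also have "exp (8 * L * T * \<tau> * k) * (\<tau> * h + k * (\<tau> * h * G)) \<le>
        exp (8 * L * T * T) * (T * h + T * h * G)"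
    proof (rule mult_mono[OF _ add_mono])
      have "8 * L * T * (real k * \<tau>) \<le> 8 * L * T * T"
        using kT L T by (intro mult_left_mono) auto
      then show "exp (8 * L * T * \<tau> * k) \<le> exp (8 * L * T * T)" by (simp add: ac_simps)
      have "(real k * \<tau>) * (h * G) \<le> T * (h * G)" using kT h G by (intro mult_right_mono) auto
      then show "k * (\<tau> * h * G) \<le> T * h * G" by (simp add: ac_simps)
    qed (use T \<tau> h G in \<open>auto intro: mult_right_mono\<close>)
    finally show ?thesis .
  qed
  have K2: "Suc K \<in> {2..n}" "K - 1 < n" "Suc (K - 1) = K" using K by auto
  have "norm (z (Suc K) - z K) \<le> s (Suc K)" using z_diff[OF K2(1)] by simp
  also have "\<dots> \<le> \<tau> * h * G + 8 * L * T * \<tau> * \<zeta> K" using s_le[OF K2(1)] by simp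
  also have "\<dots> \<le> \<tau> * h * G + 8 * L * T * \<tau> * (exp (8 * L * T * T) * (T * h + T * h * G))"
    using \<zeta>_le[OF K2(2)] L T \<tau> unfolding K2(3) by (intro add_left_mono mult_left_mono) auto
  also have "\<dots> = \<tau> * h * stability_const T L"
    by (simp add: stability_const_def Let_def G_def[symmetric] c1_def[symmetric])
      (simp add: algebra_simps)
  finally show ?thesis .
qed

end

subsection \<open>Consistency\<close>

text \<open>The mean value inequality for \<open>g t - t *\<^sub>R c\<close>.\<close>

lemma vector_derivative_increment:
  fixes g :: "real \<Rightarrow> 'a::real_normed_vector"
  assumes pq: "p \<le> q"
    and der: "\<And>t. t \<in> {p..q} \<Longrightarrow> (g has_vector_derivative g' t) (at t within {p..q})"
    and B: "\<And>t. t \<in> {p..q} \<Longrightarrow> norm (g' t - c) \<le> B"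
  shows "norm (g q - g p - (q - p) *\<^sub>R c) \<le> (q - p) * B"
proof -
  have "norm ((g q - q *\<^sub>R c) - (g p - p *\<^sub>R c)) \<le> B * norm (q - p)"
  proof (rule differentiable_bound[of "{p..q}" "\<lambda>t. g t - t *\<^sub>R c" "\<lambda>t h. h *\<^sub>R (g' t - c)"])
    fix t assume t: "t \<in> {p..q}"
    have "((\<lambda>t. g t - t *\<^sub>R c) has_vector_derivative (g' t - c)) (at t within {p..q})"
      using der[OF t] by (auto intro!: derivative_eq_intros)
    then show "((\<lambda>t. g t - t *\<^sub>R c) has_derivative (\<lambda>h. h *\<^sub>R (g' t - c))) (at t within {p..q})"
      by (simp add: has_vector_derivative_def)
    show "onorm (\<lambda>h. h *\<^sub>R (g' t - c)) \<le> B"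
    proof (rule onorm_le)
      fix h :: real
      show "norm (h *\<^sub>R (g' t - c)) \<le> B * norm h"
        using mult_right_mono[OF B[OF t] abs_ge_zero[of h]] by (simp add: mult.commute)
    qed
  qed (use pq in auto)
  then show ?thesis using pq by (simp add: algebra_simps)
qed

text \<open>The second difference is the increment over \<open>{t - \<tau>..t}\<close> of the
  function \<open>u (x + \<tau>) - u x\<close>, whose derivative is in turn an increment of
  \<open>u'\<close>. The free \<open>c\<close> allows a reference value at a point other than the
  centre.\<close>

lemma second_difference_bound:
  fixes u :: "real \<Rightarrow> 'a::real_normed_vector"
  assumes u: "\<And>t. t \<in> {0..T} \<Longrightarrow> (u has_vector_derivative u' t) (at t within {0..T})"
    and u': "\<And>t. t \<in> {0..T} \<Longrightarrow> (u' has_vector_derivative u'' t) (at t within {0..T})"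
    and near: "\<And>s. s \<in> {t - \<tau>..t + \<tau>} \<Longrightarrow> norm (u'' s - c) \<le> B"
    and t: "0 \<le> \<tau>" "0 \<le> t - \<tau>" "t + \<tau> \<le> T"
  shows "norm (u (t + \<tau>) - 2 *\<^sub>R u t + u (t - \<tau>) - \<tau>\<^sup>2 *\<^sub>R c) \<le> \<tau>\<^sup>2 * B"
proof -
  have inner: "norm (u' (x + \<tau>) - u' x - \<tau> *\<^sub>R c) \<le> \<tau> * B" if x: "x \<in> {t - \<tau>..t}" for x
  proof -
    have "norm (u' (x + \<tau>) - u' x - (x + \<tau> - x) *\<^sub>R c) \<le> (x + \<tau> - x) * B"
      using x t
      by (intro vector_derivative_increment[of x "x + \<tau>" u' u''] near
          has_vector_derivative_within_subset[OF u']) auto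
    then show ?thesis by simp
  qed
  have shift: "((\<lambda>x. u (x + \<tau>)) has_vector_derivative u' (x + \<tau>)) (at x within {t - \<tau>..t})"
    if x: "x \<in> {t - \<tau>..t}" for x
  proof -
    have "((\<lambda>x. x + \<tau>) has_vector_derivative 1) (at x within {t - \<tau>..t})"
      by (auto intro!: derivative_eq_intros)
    moreover have "(u has_vector_derivative u' (x + \<tau>)) (at (x + \<tau>) within (\<lambda>x. x + \<tau>) ` {t - \<tau>..t})"
      using x t by (intro has_vector_derivative_within_subset[OF u]) auto
    ultimately show ?thesis
      using vector_diff_chain_within[of "\<lambda>x. x + \<tau>" 1 x "{t - \<tau>..t}" u] by (simp add: o_def)
  qed
  have "norm ((u (t + \<tau>) - u t) - (u (t - \<tau> + \<tau>) - u (t - \<tau>)) - (t - (t - \<tau>)) *\<^sub>R (\<tau> *\<^sub>R c))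
      \<le> (t - (t - \<tau>)) * (\<tau> * B)"
  proof (rule vector_derivative_increment[of "t - \<tau>" t "\<lambda>x. u (x + \<tau>) - u x"])
    fix x assume x: "x \<in> {t - \<tau>..t}"
    have "(u has_vector_derivative u' x) (at x within {t - \<tau>..t})"
      using x t by (intro has_vector_derivative_within_subset[OF u]) auto
    then show "((\<lambda>x. u (x + \<tau>) - u x) has_vector_derivative (u' (x + \<tau>) - u' x)) (at x within {t - \<tau>..t})"
      by (intro has_vector_derivative_diff shift x)
  qed (use t inner in auto)
  then show ?thesis by (simp add: power2_eq_square scaleR_2 algebra_simps)
qed

lemma holder_conditionE:
  assumes "holder_condition lam S w"
  obtains C where "0 \<le> C" "\<And>t s. t \<in> S \<Longrightarrow> s \<in> S \<Longrightarrow> norm (w t - w s) \<le> C * \<bar>t - s\<bar> powr lam"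
proof -
  obtain C where C: "\<And>t s. t \<in> S \<Longrightarrow> s \<in> S \<Longrightarrow> norm (w t - w s) \<le> C * \<bar>t - s\<bar> powr lam"
    using assms by (auto simp: holder_condition_def)
  show thesis
  proof (rule that[of "max C 0"])
    fix t s assume "t \<in> S" "s \<in> S"
    then show "norm (w t - w s) \<le> max C 0 * \<bar>t - s\<bar> powr lam"
      using C[of t s] mult_right_mono[of C "max C 0" "\<bar>t - s\<bar> powr lam"] by simp
  qed simp
qed

text \<open>Converts Lipschitz bounds on a bounded interval into Hoelder bounds.\<close>

lemma le_powr_holder:
  fixes x T lam :: real
  assumes "0 \<le> x" "x \<le> T" "lam \<le> 1"
  shows "x \<le> T powr (1 - lam) * x powr lam"
proof (cases "x = 0")
  case False
  then have "x = x powr (1 - lam) * x powr lam"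
    using assms(1) by (simp add: powr_add[symmetric])
  also have "\<dots> \<le> T powr (1 - lam) * x powr lam"
    using assms by (intro mult_right_mono powr_mono2) auto
  finally show ?thesis .
qed simp

lemma continuous_on_interval_bounded:
  fixes w :: "real \<Rightarrow> 'a::real_normed_vector"
  assumes "continuous_on {p..q} w"
  obtains B where "0 \<le> B" "\<And>t. t \<in> {p..q} \<Longrightarrow> norm (w t) \<le> B"
proof -
  have "bounded (w ` {p..q})"
    using assms by (intro compact_imp_bounded compact_continuous_image) auto
  then obtain B where "0 < B" "\<And>t. t \<in> {p..q} \<Longrightarrow> norm (w t) \<le> B"
    by (auto simp: bounded_pos)
  then show thesis by (intro that[of B]) auto
qed

lemma norm_scaleR_inverse_le:
  fixes x :: "'a::real_normed_vector"
  assumes "0 < c" "norm x \<le> c * b"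
  shows "norm (x /\<^sub>R c) \<le> b"
proof -
  have "norm (x /\<^sub>R c) = norm x / c" using assms(1) by (simp add: divide_inverse mult.commute)
  then show ?thesis using assms by (simp add: pos_divide_le_eq mult.commute)
qed

text \<open>\<open>w\<close> and \<open>b\<close> cancel on the right; they only divide the residual
  into \<open>q\<close> and \<open>\<epsilon>\<close>. Taking for them the second derivative and the
  exact right side at the new time level makes the first part balanced.\<close>

lemma scheme_residual:
  fixes u1 :: "'a::real_vector"
  assumes "\<eta> \<noteq> 0" "\<tau> \<noteq> 0"
    and "\<eta> *\<^sub>R ((y - 2 *\<^sub>R v + v') /\<^sub>R \<tau>\<^sup>2) + Ay = g"
  shows "\<eta> *\<^sub>R ((u1 - y) - 2 *\<^sub>R (u0 - v) + (u' - v')) + \<tau>\<^sup>2 *\<^sub>R (Au - Ay)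
    = (\<tau>\<^sup>2 * \<eta>) *\<^sub>R ((w + (1 / \<eta>) *\<^sub>R (Au - b))
        + (((u1 - 2 *\<^sub>R u0 + u') /\<^sub>R \<tau>\<^sup>2 - w) + (1 / \<eta>) *\<^sub>R (b - g)))"
proof -
  have "\<tau>\<^sup>2 *\<^sub>R Ay = \<tau>\<^sup>2 *\<^sub>R g - \<eta> *\<^sub>R (y - 2 *\<^sub>R v + v')"
    using assms(2) unfolding assms(3)[symmetric] by (simp add: scaleR_add_right field_simps)
  then show ?thesis using assms(1,2) by (simp add: algebra_simps)
qed

subsection \<open>Convergence\<close>

theorem mainTheorem4:
  fixes A :: "'a::{real_inner, banach} \<Rightarrow> 'a" and D :: "'a set"
    and m :: nat and As :: "nat \<Rightarrow> 'a \<Rightarrow> 'a" and Ds :: "nat \<Rightarrow> 'a set"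
    and \<alpha> :: real and \<alpha>s :: "nat \<Rightarrow> real" and \<eta> :: "nat \<Rightarrow> real"
    and M :: "'a \<Rightarrow> 'a" and a :: real
    and T :: real and f :: "real \<Rightarrow> 'a" and \<phi>0 \<phi>1 :: 'a
    and u u' u'' :: "real \<Rightarrow> 'a" and lam :: real
  assumes A_self_adjoint: "self_adjoint D A"
    and A_pos: "\<alpha> > 0" "bounded_below_by \<alpha> D A"
    and As_self_adjoint: "\<And>j. j \<in> {1..m} \<Longrightarrow> self_adjoint (Ds j) (As j)"
    and As_pos: "\<And>j. j \<in> {1..m} \<Longrightarrow> \<alpha>s j > 0 \<and> bounded_below_by (\<alpha>s j) (Ds j) (As j)"
    and D_eq: "D = (\<Inter>j\<in>{1..m}. Ds j)"
    and A_eq: "\<And>x. x \<in> D \<Longrightarrow> A x = (\<Sum>j=1..m. As j x)"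
    and \<eta>_range: "\<And>j. j \<in> {1..m} \<Longrightarrow> 0 < \<eta> j \<and> \<eta> j < 1"
    and \<eta>_sum: "(\<Sum>j=1..m. \<eta> j) = 1"
    and M_lipschitz: "a > 0" "\<And>x y. norm (M x - M y) \<le> a * norm (x - y)"
    and T_pos: "T > 0"
    and f_cont: "continuous_on {0..T} f"
    and solution: "cauchy_solution D A M f \<phi>0 \<phi>1 T u u' u''"
    and lam_range: "0 < lam" "lam \<le> 1"
    and f_holder: "holder_condition lam {0..T} f"
    and u''_holder: "holder_condition lam {0..T} u''"
  shows "\<exists>c>0. \<forall>n>1. \<forall>v y. scheme_values m Ds As \<eta> M f \<phi>0 \<phi>1 T n v y \<longrightarrow>
           (\<forall>k<n. norm (u' (real k * (T / real n)) - (v (k + 1) - v k) /\<^sub>R (T / real n))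
                    \<le> c * (T / real n) powr lam)"
proof -
  \<comment> \<open>Weights over an empty index set would sum to 0; component 1 receives the whole
    right side.\<close>
  have m: "1 \<in> {1..m}" using \<eta>_sum by (cases m) auto

  \<comment> \<open>Bounds and Hoelder constants along the exact solution\<close>
  have u: "(u has_vector_derivative u' t) (at t within {0..T})"
    and u': "(u' has_vector_derivative u'' t) (at t within {0..T})"
    and uD: "u t \<in> D" and eqn: "u'' t + A (u t) + M (u t) = f t" if "t \<in> {0..T}" for t
    using solution that by (auto simp: cauchy_solution_def)
  have ode: "A (u t) = f t - u'' t - M (u t)" if "t \<in> {0..T}" for t
    unfolding eqn[OF that, symmetric] by simp
  have u''_cont: "continuous_on {0..T} u''" and Au_cont: "continuous_on {0..T} (\<lambda>t. A (u t))"
    and u0: "u 0 = \<phi>0" "u' 0 = \<phi>1"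
    using solution by (auto simp: cauchy_solution_def)
  have u'_cont: "continuous_on {0..T} u'"
    using u' by (meson continuous_on_eq_continuous_within has_vector_derivative_continuous)
  obtain U where U: "0 \<le> U" "\<And>t. t \<in> {0..T} \<Longrightarrow> norm (u' t) \<le> U"
    using continuous_on_interval_bounded[OF u'_cont] by blast
  obtain V where V: "0 \<le> V" "\<And>t. t \<in> {0..T} \<Longrightarrow> norm (u'' t) \<le> V"
    using continuous_on_interval_bounded[OF u''_cont] by blast
  obtain W where W: "0 \<le> W" "\<And>t. t \<in> {0..T} \<Longrightarrow> norm (A (u t)) \<le> W"
    using continuous_on_interval_bounded[OF Au_cont] by blast
  obtain Cf where Cf: "0 \<le> Cf" "\<And>t s. t \<in> {0..T} \<Longrightarrow> s \<in> {0..T} \<Longrightarrow> norm (f t - f s) \<le> Cf * \<bar>t - s\<bar> powr lam"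
    using holder_conditionE[OF f_holder] by blast
  obtain Cu where Cu: "0 \<le> Cu" "\<And>t s. t \<in> {0..T} \<Longrightarrow> s \<in> {0..T} \<Longrightarrow> norm (u'' t - u'' s) \<le> Cu * \<bar>t - s\<bar> powr lam"
    using holder_conditionE[OF u''_holder] by blast
  define P where "P = T powr (1 - lam)"
  have P0: "0 \<le> P" by (simp add: P_def)
  have P: "x \<le> P * x powr lam" if "0 \<le> x" "x \<le> T" for x
    unfolding P_def using le_powr_holder[OF that lam_range(2)] .

  have inc_u: "norm (u t - u s - (t - s) *\<^sub>R c) \<le> (t - s) * B"
    if "0 \<le> s" "s \<le> t" "t \<le> T" "\<And>r. r \<in> {s..t} \<Longrightarrow> norm (u' r - c) \<le> B" for s t c B
    using that
    by (intro vector_derivative_increment[where g' = u'] has_vector_derivative_within_subset[OF u]) auto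
  have inc_u': "norm (u' t - u' s) \<le> (t - s) * V" if "0 \<le> s" "s \<le> t" "t \<le> T" for s t
  proof -
    have "norm (u' t - u' s - (t - s) *\<^sub>R 0) \<le> (t - s) * V"
      using that V(2)
      by (intro vector_derivative_increment[where g' = u''] has_vector_derivative_within_subset[OF u']) auto
    then show ?thesis by simp
  qed
  have lip_u: "norm (u t - u s) \<le> U * \<bar>t - s\<bar>" if "t \<in> {0..T}" "s \<in> {0..T}" for s t
  proof (cases "s \<le> t")
    case True
    then show ?thesis using inc_u[of s t 0 U] that U(2) by (simp add: mult.commute)
  next
    case False
    then show ?thesis using inc_u[of t s 0 U] that U(2) by (simp add: mult.commute norm_minus_commute)
  qed
  have MU: "norm (M (u t) - M (u s)) \<le> a * U * P * \<bar>t - s\<bar> powr lam"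
    if "t \<in> {0..T}" "s \<in> {0..T}" for t s
  proof -
    have "norm (M (u t) - M (u s)) \<le> a * (U * \<bar>t - s\<bar>)"
      using M_lipschitz(2)[of "u t" "u s"] lip_u[OF that] M_lipschitz(1)
      by (meson less_imp_le mult_left_mono order_trans)
    also have "\<dots> \<le> a * (U * (P * \<bar>t - s\<bar> powr lam))"
      using M_lipschitz(1) U(1) that by (intro mult_left_mono P) auto
    finally show ?thesis by (simp add: ac_simps)
  qed
  define CA where "CA = Cf + Cu + a * U * P"
  \<comment> \<open>The differential equation expresses \<open>A (u t)\<close> through
    \<open>f\<close>, \<open>u''\<close> and \<open>M (u t)\<close>, and so passes their Hoelder
    bounds on to it.\<close>
  have CA: "norm (A (u t) - A (u s)) \<le> CA * \<bar>t - s\<bar> powr lam"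
    if "t \<in> {0..T}" "s \<in> {0..T}" for t s
  proof -
    have "A (u t) - A (u s) = (f t - f s) - (u'' t - u'' s) - (M (u t) - M (u s))"
      unfolding ode[OF that(1)] ode[OF that(2)] by simp
    also have "norm \<dots> \<le> norm (f t - f s) + norm (u'' t - u'' s) + norm (M (u t) - M (u s))"
      by (rule order_trans[OF norm_triangle_ineq4 add_right_mono[OF norm_triangle_ineq4]])
    also have "\<dots> \<le> CA * \<bar>t - s\<bar> powr lam"
      using Cf(2)[OF that] Cu(2)[OF that] MU[OF that] by (simp add: CA_def algebra_simps)
    finally show ?thesis .
  qed

  \<comment> \<open>Relative bounds of the summands of the operator\<close>
  have "\<exists>K\<ge>0. \<forall>x\<in>D. norm (As j x) \<le> K * norm (A x)" if "j \<in> {1..m}" for j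
    using that D_eq by (intro relatively_bounded[OF A_self_adjoint A_pos As_self_adjoint]) auto
  then obtain Kj where Kj: "\<And>j. j \<in> {1..m} \<Longrightarrow> 0 \<le> Kj j"
    "\<And>j x. j \<in> {1..m} \<Longrightarrow> x \<in> D \<Longrightarrow> norm (As j x) \<le> Kj j * norm (A x)"
    by metis
  define K where "K = (\<Sum>j=1..m. Kj j)"
  have K0: "0 \<le> K" unfolding K_def using Kj(1) by (intro sum_nonneg) auto
  have K: "norm (As j x) \<le> K * norm (A x)" if j: "j \<in> {1..m}" and x: "x \<in> D" for j x
  proof -
    have "Kj j \<le> K" unfolding K_def using Kj(1) j by (intro member_le_sum) auto
    then show ?thesis using Kj(2)[OF j x] mult_right_mono[of "Kj j" K "norm (A x)"] by simp
  qed
  have As_diff: "norm (As j (u t) - As j (u s)) \<le> K * (CA * \<bar>t - s\<bar> powr lam)"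
    if j: "j \<in> {1..m}" and ts: "t \<in> {0..T}" "s \<in> {0..T}" for j t s
  proof -
    have D: "u t \<in> D" "u s \<in> D" "u t \<in> Ds j" "u s \<in> Ds j"
      using uD ts j D_eq by auto
    have "u t - u s \<in> D"
      using D self_adjointD(2)[OF A_self_adjoint] by (auto intro: subspace_diff)
    then have "norm (As j (u t) - As j (u s)) \<le> K * norm (A (u t) - A (u s))"
      using K[OF j] linear_operator_diff[OF self_adjointD(1)[OF As_self_adjoint[OF j]] D(3,4)]
        linear_operator_diff[OF self_adjointD(1)[OF A_self_adjoint] D(1,2)] by metis
    also have "\<dots> \<le> K * (CA * \<bar>t - s\<bar> powr lam)" using CA[OF ts] K0 by (intro mult_left_mono)
    finally show ?thesis .
  qed

  \<comment> \<open>Uniform bound for the inverse weights\<close>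
  define \<kappa> where "\<kappa> = (\<Sum>j=1..m. 1 / \<eta> j)"
  have \<eta>_inv: "0 < 1 / \<eta> j" if "j \<in> {1..m}" for j using \<eta>_range[OF that] by simp
  have \<kappa>: "1 / \<eta> j \<le> \<kappa>" if "j \<in> {1..m}" for j
    unfolding \<kappa>_def using \<eta>_inv by (intro member_le_sum that) (auto intro: less_imp_le)
  have \<kappa>0: "0 \<le> \<kappa>" using \<kappa>[OF m] \<eta>_inv[OF m] by linarith
  have \<kappa>_scale: "norm ((1 / \<eta> j) *\<^sub>R x) \<le> \<kappa> * b" if "j \<in> {1..m}" "norm x \<le> b" for j b and x :: 'a
  proof -
    have "norm ((1 / \<eta> j) *\<^sub>R x) = (1 / \<eta> j) * norm x" using \<eta>_inv[OF that(1)] by simp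
    also have "\<dots> \<le> \<kappa> * b" using \<kappa>[OF that(1)] that(2) \<kappa>0 by (intro mult_mono) auto
    finally show ?thesis .
  qed

  \<comment> \<open>The splitting defect of the exact solution\<close>
  define b where "b t j = (if j = 1 then u'' t + A (u t) else 0)" for t and j :: nat
  \<comment> \<open>\<open>b\<close> is the exact right side \<open>f t - M (u t)\<close>, written
    through the equation and assigned to component 1 as in the scheme.
    \<open>\<eta> j *\<^sub>R r t j\<close> is what the exact solution leaves over in the
    \<open>j\<close>-th split equation.\<close>
  define r where "r t j = u'' t + (1 / \<eta> j) *\<^sub>R (As j (u t) - b t j)" for t j
  define Cq where "Cq = Cu + \<kappa> * (K * CA + (Cu + CA))"
  define Q where "Q = V + \<kappa> * (K * W + (V + W))"
  have r_bound: "norm (r t j) \<le> Q" if j: "j \<in> {1..m}" and t: "t \<in> {0..T}" for t j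
  proof -
    have "norm (As j (u t)) \<le> K * W"
      using K[OF j uD[OF t]] mult_left_mono[OF W(2)[OF t] K0] by simp
    moreover have "norm (b t j) \<le> V + W"
      using norm_triangle_ineq[of "u'' t" "A (u t)"] V W(2)[OF t] V(2)[OF t] W(1) by (auto simp: b_def)
    ultimately have "norm (As j (u t) - b t j) \<le> K * W + (V + W)"
      using norm_triangle_ineq4[of "As j (u t)" "b t j"] by simp
    from \<kappa>_scale[OF j this] show ?thesis
      unfolding r_def Q_def using V(2)[OF t] by (intro order_trans[OF norm_triangle_ineq add_mono])
  qed
  have r_diff: "norm (r t j - r s j) \<le> Cq * \<bar>t - s\<bar> powr lam"
    if j: "j \<in> {1..m}" and ts: "t \<in> {0..T}" "s \<in> {0..T}" for t s j
  proof -
    define d where "d = \<bar>t - s\<bar> powr lam"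
    have d: "0 \<le> d" by (simp add: d_def)
    have "norm ((u'' t - u'' s) + (A (u t) - A (u s))) \<le> Cu * d + CA * d"
      unfolding d_def by (intro order_trans[OF norm_triangle_ineq] add_mono Cu(2) CA ts)
    moreover have "0 \<le> Cu * d + CA * d" using calculation norm_ge_zero order_trans by blast
    ultimately have "norm (b t j - b s j) \<le> Cu * d + CA * d"
      by (auto simp: b_def algebra_simps)
    then have "norm ((As j (u t) - As j (u s)) - (b t j - b s j)) \<le> K * (CA * d) + (Cu * d + CA * d)"
      using norm_triangle_ineq4[of "As j (u t) - As j (u s)" "b t j - b s j"] As_diff[OF j ts]
      unfolding d_def by linarith
    from \<kappa>_scale[OF j this]
    have "norm ((u'' t - u'' s) + (1 / \<eta> j) *\<^sub>R ((As j (u t) - As j (u s)) - (b t j - b s j)))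
        \<le> Cu * d + \<kappa> * (K * (CA * d) + (Cu * d + CA * d))"
      unfolding d_def by (intro order_trans[OF norm_triangle_ineq] add_mono Cu(2) ts)
    moreover have "r t j - r s j
        = (u'' t - u'' s) + (1 / \<eta> j) *\<^sub>R ((As j (u t) - As j (u s)) - (b t j - b s j))"
      by (simp add: r_def algebra_simps)
    moreover have "Cu * d + \<kappa> * (K * (CA * d) + (Cu * d + CA * d)) = Cq * \<bar>t - s\<bar> powr lam"
      by (simp add: Cq_def d_def algebra_simps)
    ultimately show ?thesis by (simp only:)
  qed

  interpret weighted_operators "{1..m}" \<eta> Ds As
  proof
    show "0 \<le> As j x \<bullet> x" if "j \<in> {1..m}" "x \<in> Ds j" for j x
      using As_pos[OF that(1)] that(2) unfolding bounded_below_by_def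
      by (meson less_imp_le mult_nonneg_nonneg order_trans zero_le_power2)
  qed (use \<eta>_range \<eta>_sum As_self_adjoint in auto)

  \<comment> \<open>Weighting cancels the factors \<open>1 / \<eta> j\<close>; the operators sum to
    \<open>A (u t)\<close>, and \<open>b\<close> sums to \<open>u'' t + A (u t)\<close> at the same
    time \<open>t\<close>.\<close>
  have r_mean: "mean (r t) = 0" if t: "t \<in> {0..T}" for t
  proof -
    have "mean (r t) = (\<Sum>j=1..m. \<eta> j *\<^sub>R u'' t + As j (u t) - b t j)"
      unfolding mean_def r_def
    proof (intro sum.cong refl)
      fix j assume "j \<in> {1..m}"
      then have "\<eta> j \<noteq> 0" using \<eta>_range by force
      then show "\<eta> j *\<^sub>R (u'' t + (1 / \<eta> j) *\<^sub>R (As j (u t) - b t j)) = \<eta> j *\<^sub>R u'' t + As j (u t) - b t j"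
        by (simp add: scaleR_add_right)
    qed
    also have "\<dots> = u'' t + A (u t) - (\<Sum>j=1..m. b t j)"
      using A_eq[OF uD[OF t]] mean_const[of "u'' t", unfolded mean_def]
      by (simp add: sum.distrib sum_subtractf)
    also have "(\<Sum>j=1..m. b t j) = u'' t + A (u t)"
      using m by (simp add: b_def)
    finally show ?thesis by simp
  qed

  \<comment> \<open>One summand per requirement: \<open>V * P\<close> for one-step increments of
    \<open>u'\<close>, \<open>Q * P\<close> for the size of \<open>q\<close>, \<open>Cq\<close> for
    its increments, the last two for \<open>\<epsilon>\<close>. Then
    \<open>h = H * \<tau> powr lam\<close> serves for all of them.\<close>
  define H where "H = V * P + Q * P + Cq + Cu * 2 powr lam + \<kappa> * (Cf + a * U * P)"
  define S where "S = stability_const T (\<kappa> * a)"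
  have CA0: "0 \<le> CA" using Cf(1) Cu(1) M_lipschitz(1) U(1) P0 by (simp add: CA_def)
  have Q0: "0 \<le> Q" using V(1) W(1) K0 \<kappa>0 by (simp add: Q_def)
  have Cq0: "0 \<le> Cq" using Cu(1) CA0 K0 \<kappa>0 by (simp add: Cq_def)
  have parts: "0 \<le> V * P" "0 \<le> Q * P" "0 \<le> Cu * 2 powr lam" "0 \<le> \<kappa> * (Cf + a * U * P)"
    using V(1) P0 Q0 Cu(1) \<kappa>0 Cf(1) M_lipschitz(1) U(1) by auto
  have H0: "0 \<le> H" using parts Cq0 by (simp add: H_def)

  \<comment> \<open>Error estimate for a fixed step\<close>
  have main: "norm (u' (real k * (T / real n)) - (v (k + 1) - v k) /\<^sub>R (T / real n))
      \<le> (H + H * S) * (T / real n) powr lam"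
    if n: "n > 1" and scheme: "scheme_values m Ds As \<eta> M f \<phi>0 \<phi>1 T n v y" and k: "1 \<le> k" "k < n"
    for n v y k
  proof -
    define \<tau> where "\<tau> = T / real n"
    define t where "t i = real i * \<tau>" for i
    define h where "h = H * \<tau> powr lam"
    have \<tau>: "0 < \<tau>" "real n * \<tau> = T" using n T_pos by (auto simp: \<tau>_def)
    have \<tau>T: "\<tau> \<le> T" using n T_pos by (simp add: \<tau>_def field_simps)
    have tT: "t i \<in> {0..T}" if "i \<le> n" for i
      using that \<tau> mult_right_mono[of "real i" "real n" \<tau>] by (auto simp: t_def)
    have t_diff: "\<bar>t (Suc i) - t i\<bar> = \<tau>" for i using \<tau> by (simp add: t_def algebra_simps)
    have h_ge: "V * P * \<tau> powr lam \<le> h" "Q * P * \<tau> powr lam \<le> h" "Cq * \<tau> powr lam \<le> h"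
      "(Cu * 2 powr lam + \<kappa> * (Cf + a * U * P)) * \<tau> powr lam \<le> h"
      unfolding h_def using parts Cq0 by (auto intro!: mult_right_mono simp: H_def)
    have \<tau>P: "\<tau> \<le> P * \<tau> powr lam" using P \<tau> \<tau>T by simp
    have V\<tau>: "V * \<tau> \<le> h" using mult_left_mono[OF \<tau>P V(1)] h_ge(1) by (simp add: mult.assoc)
    have Q\<tau>: "\<tau> * Q \<le> h" using mult_left_mono[OF \<tau>P Q0] h_ge(2) by (simp add: ac_simps)
    have sv: "v 0 = \<phi>0" "v 1 = \<phi>0 + \<tau> *\<^sub>R \<phi>1"
      and sv_mean: "\<And>i. i \<in> {1..<n} \<Longrightarrow> v (Suc i) = mean (\<lambda>j. y j (Suc i))"
      and sy: "\<And>i j. i \<in> {1..<n} \<Longrightarrow> j \<in> {1..m} \<Longrightarrow> y j (Suc i) \<in> Ds j"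
      and seq: "\<And>i j. i \<in> {1..<n} \<Longrightarrow> j \<in> {1..m} \<Longrightarrow>
        \<eta> j *\<^sub>R ((y j (Suc i) - 2 *\<^sub>R v i + v (i - 1)) /\<^sub>R \<tau>\<^sup>2) + As j (y j (Suc i))
          = (if j = 1 then f (t i) - M (v i) else 0)"
      using scheme n unfolding scheme_values_def Let_def \<tau>_def[symmetric] t_def mean_def by auto
    define z where "z i = u (t i) - v i" for i
    define Y where "Y i j = u (t i) - y j i" for i j
    define q where "q i j = r (t i) j" for i j
    define g where "g i j = (if j = 1 then f (t i) - M (v i) else 0)" for i and j :: nat
    define \<epsilon> where "\<epsilon> i j = ((u (t (Suc i)) - 2 *\<^sub>R u (t i) + u (t (i - 1))) /\<^sub>R \<tau>\<^sup>2 - u'' (t (Suc i)))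
        + (1 / \<eta> j) *\<^sub>R (b (t (Suc i)) j - g i j)" for i j
    have uDs: "u (t i) \<in> Ds j" if "i \<le> n" "j \<in> {1..m}" for i j
      using uD[OF tT[OF that(1)]] that(2) D_eq by auto
    have \<epsilon>: "norm (\<epsilon> i j) \<le> h + \<kappa> * a * norm (z i)" if i: "i \<in> {1..<n}" and j: "j \<in> {1..m}" for i j
    proof -
      have i': "Suc i \<le> n" "i \<le> n" using i by auto
      have ti: "t (Suc i) = t i + \<tau>" "t (i - 1) = t i - \<tau>"
        using i by (auto simp: t_def algebra_simps of_nat_diff)
      \<comment> \<open>The second difference is centred at \<open>t i\<close>, but
        \<open>u''\<close> is taken at \<open>t (Suc i)\<close>, the time of the implicit operator
        term; hence the distance \<open>2 * \<tau>\<close>.\<close>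
      have near: "norm (u'' x - u'' (t (Suc i))) \<le> Cu * (2 * \<tau>) powr lam"
        if x: "x \<in> {t i - \<tau>..t i + \<tau>}" for x
      proof -
        have "t (i - 1) \<in> {0..T}" using i by (intro tT) auto
        then have xT: "x \<in> {0..T}" using x tT[OF i'(1)] unfolding ti by auto
        have "\<bar>x - t (Suc i)\<bar> powr lam \<le> (2 * \<tau>) powr lam"
          using x lam_range unfolding ti by (intro powr_mono2) auto
        then show ?thesis
          using Cu(2)[OF xT tT[OF i'(1)]] mult_left_mono[OF _ Cu(1)] by (meson order_trans)
      qed
      have "norm (u (t i + \<tau>) - 2 *\<^sub>R u (t i) + u (t i - \<tau>) - \<tau>\<^sup>2 *\<^sub>R u'' (t (Suc i)))
          \<le> \<tau>\<^sup>2 * (Cu * (2 * \<tau>) powr lam)"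
      proof (rule second_difference_bound[OF u u' near])
        show "0 \<le> t i - \<tau>" using tT[of "i - 1"] i unfolding ti by auto
        show "t i + \<tau> \<le> T" using tT[OF i'(1)] unfolding ti by auto
      qed (use \<tau> in auto)
      then have "norm ((u (t (Suc i)) - 2 *\<^sub>R u (t i) + u (t (i - 1)) - \<tau>\<^sup>2 *\<^sub>R u'' (t (Suc i))) /\<^sub>R \<tau>\<^sup>2)
          \<le> Cu * (2 * \<tau>) powr lam"
        using \<tau> unfolding ti by (intro norm_scaleR_inverse_le) auto
      moreover have "(x - \<tau>\<^sup>2 *\<^sub>R w) /\<^sub>R \<tau>\<^sup>2 = x /\<^sub>R \<tau>\<^sup>2 - w" for x w :: 'a
        using \<tau>(1) by (simp add: scaleR_diff_right)
      ultimately have first: "norm ((u (t (Suc i)) - 2 *\<^sub>R u (t i) + u (t (i - 1))) /\<^sub>R \<tau>\<^sup>2 - u'' (t (Suc i)))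
          \<le> Cu * 2 powr lam * \<tau> powr lam"
        using \<tau> by (simp only: powr_mult mult.assoc)
      \<comment> \<open>The scheme evaluates the right side one time level earlier and at
        \<open>v i\<close>: the lag costs Hoelder terms, the replacement of \<open>u\<close> by
        \<open>v\<close> the term in \<open>z i\<close>.\<close>
      have second: "norm (b (t (Suc i)) j - g i j) \<le> Cf * \<tau> powr lam + a * U * P * \<tau> powr lam + a * norm (z i)"
      proof (cases "j = 1")
        case True
        then have "b (t (Suc i)) j - g i j = (f (t (Suc i)) - f (t i))
            - (M (u (t (Suc i))) - M (u (t i))) - (M (u (t i)) - M (v i))"
          using ode[OF tT[OF i'(1)]] by (simp add: b_def g_def)
        also have "norm \<dots> \<le> norm (f (t (Suc i)) - f (t i)) + norm (M (u (t (Suc i))) - M (u (t i)))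
            + norm (M (u (t i)) - M (v i))"
          by (rule order_trans[OF norm_triangle_ineq4 add_right_mono[OF norm_triangle_ineq4]])
        also have "\<dots> \<le> Cf * \<tau> powr lam + a * U * P * \<tau> powr lam + a * norm (z i)"
          using Cf(2)[OF tT[OF i'(1)] tT[OF i'(2)]] MU[OF tT[OF i'(1)] tT[OF i'(2)]]
            M_lipschitz(2)[of "u (t i)" "v i"] unfolding t_diff z_def by linarith
        finally show ?thesis .
      next
        case False
        then show ?thesis using Cf(1) M_lipschitz(1) U(1) P0 by (simp add: b_def g_def)
      qed
      have "norm (\<epsilon> i j) \<le> Cu * 2 powr lam * \<tau> powr lam
          + \<kappa> * (Cf * \<tau> powr lam + a * U * P * \<tau> powr lam + a * norm (z i))"
        unfolding \<epsilon>_def using first \<kappa>_scale[OF j second]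
        by (intro order_trans[OF norm_triangle_ineq] add_mono)
      also have "\<dots> = (Cu * 2 powr lam + \<kappa> * (Cf + a * U * P)) * \<tau> powr lam + \<kappa> * a * norm (z i)"
        by (simp add: algebra_simps)
      finally show ?thesis using h_ge(4) by linarith
    qed
    have z1: "norm (z 1) \<le> \<tau> * h"
    proof -
      have "norm (u \<tau> - u 0 - (\<tau> - 0) *\<^sub>R \<phi>1) \<le> (\<tau> - 0) * h"
      proof (rule inc_u)
        fix x assume x: "x \<in> {0..\<tau>}"
        have "norm (u' x - \<phi>1) \<le> (x - 0) * V"
          unfolding u0(2)[symmetric] using x \<tau>T by (intro inc_u') auto
        also have "\<dots> \<le> V * \<tau>" using x V(1) by (simp add: mult.commute mult_left_mono)
        finally show "norm (u' x - \<phi>1) \<le> h" using V\<tau> by simp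
      qed (use \<tau> \<tau>T in auto)
      then show ?thesis using sv(2) u0 by (simp add: z_def t_def algebra_simps)
    qed
    \<comment> \<open>The Lipschitz error of \<open>M\<close> is divided by the weights, so
      \<open>\<kappa> * a\<close> takes the place of \<open>L\<close>.\<close>
    have "norm (z (Suc k) - z k) \<le> \<tau> * h * stability_const T (\<kappa> * a)"
    proof (rule stability[where n = n and Y = Y and q = q and \<epsilon> = \<epsilon>])
      fix i j assume i: "i \<in> {1..<n}" and j: "j \<in> {1..m}"
      have "\<eta> j \<noteq> 0" using \<eta>_range[OF j] by simp
      moreover have "As j (Y (Suc i) j) = As j (u (t (Suc i))) - As j (y j (Suc i))"
        unfolding Y_def
        using linear_operator_diff[OF self_adjointD(1)[OF As_self_adjoint[OF j]] uDs[OF _ j] sy[OF i j]] i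
        by simp
      ultimately show "\<eta> j *\<^sub>R (Y (Suc i) j - 2 *\<^sub>R z i + z (i - 1)) + \<tau>\<^sup>2 *\<^sub>R As j (Y (Suc i) j)
          = (\<tau>\<^sup>2 * \<eta> j) *\<^sub>R (q (Suc i) j + \<epsilon> i j)"
        using scheme_residual[OF _ _ seq[OF i j, folded g_def], of "u (t (Suc i))" "u (t i)" "u (t (i - 1))"
            "As j (u (t (Suc i)))" "u'' (t (Suc i))" "b (t (Suc i)) j"] \<tau>(1)
        by (simp add: Y_def z_def q_def r_def \<epsilon>_def)
      show "norm (\<epsilon> i j) \<le> h + \<kappa> * a * norm (z i)" using \<epsilon>[OF i j] .
    next
      fix i assume i: "i \<in> {2..n}"
      then have i': "i - 1 \<in> {1..<n}" "Suc (i - 1) = i" "i \<le> n" by auto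
      show "z i = mean (Y i)"
        using sv_mean[OF i'(1)] unfolding i'(2)
        by (simp add: z_def Y_def[abs_def] mean_diff mean_const del: One_nat_def)
      show "mean (q i) = 0"
        using r_mean[OF tT[OF i'(3)]] by (simp add: q_def[abs_def] del: One_nat_def)
      fix j assume j: "j \<in> {1..m}"
      show "Y i j \<in> Ds j"
        unfolding Y_def using sy[OF i'(1) j] uDs[OF i'(3) j] self_adjointD(2)[OF As_self_adjoint[OF j]]
        unfolding i'(2) by (intro subspace_diff)
      have "\<tau> * norm (q i j) \<le> \<tau> * Q"
        unfolding q_def using r_bound[OF j tT[OF i'(3)]] \<tau>(1) by (intro mult_left_mono) auto
      then show "\<tau> * norm (q i j) \<le> h" using Q\<tau> by simp
    next
      fix i j assume i: "i \<in> {2..<n}" and j: "j \<in> {1..m}"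
      have "norm (q (Suc i) j - q i j) \<le> Cq * \<tau> powr lam"
        unfolding q_def using r_diff[OF j tT tT, of "Suc i" i] i t_diff by simp
      then show "norm (q (Suc i) j - q i j) \<le> h" using h_ge(3) by simp
    qed (use \<tau> \<kappa>0 M_lipschitz(1) H0 z1 k sv(1) u0(1) in \<open>auto simp: h_def z_def t_def\<close>)
    then have "norm ((z (Suc k) - z k) /\<^sub>R \<tau>) \<le> h * S"
      using \<tau> unfolding S_def by (intro norm_scaleR_inverse_le) (auto simp: mult.assoc)
    moreover have "norm (u' (t k) - (u (t (Suc k)) - u (t k)) /\<^sub>R \<tau>) \<le> h"
    proof -
      have tk: "t (Suc k) - t k = \<tau>" "t k \<in> {0..T}" "t (Suc k) \<in> {0..T}"
        using k tT[of k] tT[of "Suc k"] by (simp_all add: t_def algebra_simps)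
      have "norm (u (t (Suc k)) - u (t k) - (t (Suc k) - t k) *\<^sub>R u' (t k)) \<le> (t (Suc k) - t k) * h"
      proof (rule inc_u)
        fix x assume x: "x \<in> {t k..t (Suc k)}"
        have "norm (u' x - u' (t k)) \<le> (x - t k) * V" using x tk by (intro inc_u') auto
        also have "\<dots> \<le> \<tau> * V" using x tk(1) V(1) by (intro mult_right_mono) auto
        finally show "norm (u' x - u' (t k)) \<le> h" using V\<tau> by (simp add: mult.commute)
      qed (use tk \<tau> in auto)
      then have "norm ((u (t (Suc k)) - u (t k) - \<tau> *\<^sub>R u' (t k)) /\<^sub>R \<tau>) \<le> h"
        using \<tau> unfolding tk(1) by (intro norm_scaleR_inverse_le) auto
      moreover have "(u (t (Suc k)) - u (t k) - \<tau> *\<^sub>R u' (t k)) /\<^sub>R \<tau>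
          = (u (t (Suc k)) - u (t k)) /\<^sub>R \<tau> - u' (t k)"
        using \<tau> by (simp add: scaleR_diff_right)
      ultimately show ?thesis by (simp add: norm_minus_commute)
    qed
    moreover have "u' (t k) - (v (Suc k) - v k) /\<^sub>R \<tau>
        = (u' (t k) - (u (t (Suc k)) - u (t k)) /\<^sub>R \<tau>) + (z (Suc k) - z k) /\<^sub>R \<tau>"
      by (simp add: z_def algebra_simps)
    ultimately have "norm (u' (t k) - (v (Suc k) - v k) /\<^sub>R \<tau>) \<le> h + h * S"
      by (metis add_mono norm_triangle_le)
    then show ?thesis by (simp add: t_def \<tau>_def h_def algebra_simps)
  qed
  have S0: "0 \<le> S"
    using T_pos \<kappa>0 M_lipschitz(1) by (simp add: S_def stability_const_def Let_def)
  show ?thesis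
  \<comment> \<open>Adding 1 makes the constant positive even if \<open>H\<close> is 0. At
    \<open>k = 0\<close> the difference quotient is exactly \<open>\<phi>1\<close>, so the error
    there is 0.\<close>
  proof (intro exI[of _ "H + H * S + 1"] conjI allI impI)
    show "0 < H + H * S + 1" using H0 S0 by (simp add: add_nonneg_pos)
    fix n v y k assume n: "n > 1" and scheme: "scheme_values m Ds As \<eta> M f \<phi>0 \<phi>1 T n v y" and k: "k < n"
    show "norm (u' (real k * (T / real n)) - (v (k + 1) - v k) /\<^sub>R (T / real n))
        \<le> (H + H * S + 1) * (T / real n) powr lam"
    proof (cases "k = 0")
      case True
      have "v 0 = \<phi>0" "v 1 = \<phi>0 + (T / real n) *\<^sub>R \<phi>1"
        using scheme by (auto simp: scheme_values_def Let_def)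
      then show ?thesis using True u0(2) n T_pos H0 S0 by simp
    next
      case False
      then have "norm (u' (real k * (T / real n)) - (v (k + 1) - v k) /\<^sub>R (T / real n))
          \<le> (H + H * S) * (T / real n) powr lam"
        using main[OF n scheme] k by simp
      also have "\<dots> \<le> (H + H * S + 1) * (T / real n) powr lam" by (intro mult_right_mono) auto
      finally show ?thesis .
    qed
  qed
qed

end
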